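(* With the setting and notation of the context (with $m=\tfrac{q(q+1)}2$), the filtered curvature coefficients $\widehat{\boldsymbol\alpha}_{(2)}^r(\boldsymbol\nu):=\widehat{\mathbf U}_{(2)}^{r\top}\mathbf v(\boldsymbol\nu)\in\mathbb R^m$ satisfy, as $r\to0$ and uniformly for $\boldsymbol\nu\in\mathcal B(\boldsymbol 0,r)$, \[ \widehat{\boldsymbol\alpha}_{(2)}^r(\boldsymbol\nu)=\mathbf R^r\,\mathrm{vecsym}\Big(\big(\mathbf B^r\boldsymbol\alpha_{(1)}^r(\boldsymbol\nu)\big)\big(\mathbf B^r\boldsymbol\alpha_{(1)}^r(\boldsymbol\nu)\big)^\top\Big)+\mathcal O\Big(r\|\boldsymbol\alpha_{(1)}^r(\boldsymbol\nu)\|^2+\|\boldsymbol\alpha_{(1)}^r(\boldsymbol\nu)\|^3\Big), \] where $\boldsymbol\alpha_{(1)}^r(\boldsymbol\nu)=\mathbf U_{(1)}^{r\top}\mathbf v(\boldsymbol\nu)\in\mathbb R^q$, $\mathbf R^r=(\mathbf O_{(2)}^r)^\top\mathbf R\in\mathbb R^{m\times m}$ and $\mathbf B^r=(\mathbf A^* )^{-1}\mathbf O_{(1)}^r\in\mathbb R^{q\times q}$. In particular, the leading term is homogeneous quadratic in $\boldsymbol\alpha_{(1)}^r(\boldsymbol\nu)$, and the remainder is $\mathcal O(r^3)$ when $\|\boldsymbol\nu\|\le r$.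
   Context: Setting. $\mathcal S$ is an embedded submanifold of dimension $q$ of $\mathbb R^{\mathcal M}$ ($\mathcal M\gg q$), and $\mathbf u^*\in\mathcal S$. $U:\mathcal Q^0\to\mathbb R^{\mathcal M}$ is the inverse of a chart of $\mathcal S$ around $\mathbf u^*$: $\mathcal Q^0\subset\mathbb R^q$ is open and contains the closed unit ball $\mathcal B(\boldsymbol 0,1)$, $U$ is a homeomorphism onto an open subset of $\mathcal S$, and $U(\boldsymbol 0)=\mathbf u^*$. Put $\mathbf v(\boldsymbol\nu)=U(\boldsymbol\nu)-\mathbf u^*$; $\mathcal B(\boldsymbol 0,r)$ is the closed Euclidean ball of radius $r$ in $\mathbb R^q$. Standing assumptions: $U$ is of class $C^3$; at every point of $\mathcal Q^0$ the Jacobian $\mathbf J_U(\boldsymbol\nu)\in\mathbb R^{\mathcal M\times q}$ has rank $q$, and the second fundamental form has maximal rank, i.e. the components of the second derivatives $\partial_{\nu_j}\partial_{\nu_\ell}U$, $1\le j\le\ell\le q$, orthogonal to the tangent space $\mathrm{Range}(\mathbf J_U(\boldsymbol\nu))$ span a space of dimension $\tfrac12q(q+1)$. Sampling. $\boldsymbol\nu^1,\dots,\boldsymbol\nu^M\in\mathcal B(\boldsymbol 0,1)$ are fixed points such that $\mathbf P=[\boldsymbol\nu^1,\dots,\boldsymbol\nu^M]\in\mathbb R^{q\times M}$ has rank $q$. For small $r>0$, $\mathbf S^r\in\mathbb R^{\mathcal M\times M}$ is the matrix with columns $U(r\boldsymbol\nu^i)-\mathbf u^*$. Let $\mathcal I=\{(j,\ell):1\le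 j\le\ell\le q\}$, $m=|\mathcal I|=\tfrac{q(q+1)}2$. For a symmetric $q\times q$ matrix $\mathbf A=(a_{ij})$, $\mathrm{vecsym}(\mathbf A)\in\mathbb R^m$ is the vector of its upper triangular entries, row by row: $(a_{11},a_{12},\dots,a_{1q},a_{22},\dots,a_{2q},\dots,a_{qq})^\top$; $\mathcal I$ is ordered accordingly. The matrix $\mathbf P_2=[\mathrm{vecsym}(\boldsymbol\nu^1\boldsymbol\nu^{1\top}),\dots,\mathrm{vecsym}(\boldsymbol\nu^M\boldsymbol\nu^{M\top})]\in\mathbb R^{m\times M}$ is assumed to have rank $m$. First-order block. $\mathbf U_{(1)}^r$ (resp. $\mathbf U_{(1)}^*$) in $\mathbb R^{\mathcal M\times q}$ is the matrix of the first $q$ (orthonormal) left singular vectors of $\mathbf S^r$ (resp. of $\mathbf J_U(\boldsymbol 0)\mathbf P$). $\Pi_0=\mathbf U_{(1)}^*\mathbf U_{(1)}^{*\top}$ is the orthogonal projection onto the tangent space $\mathrm{Range}(\mathbf J_U(\boldsymbol 0))$. $\mathbf A^*=\mathbf U_{(1)}^{*\top}\mathbf J_U(\boldsymbol 0)\in\mathbb R^{q\times q}$ (invertible). $\mathbf O_{(1)}^r$ is an orthogonal $q\times q$ matrix with $\|\mathbf U_{(1)}^r-\mathbf U_{(1)}^*\mathbf O_{(1)}^r\|=\mathcal O(r)$; explicitly, it is the minimizer of $\|\mathbf U_{(1)}^r-\mathbf U_{(1)}^*\mathbf O\|_F$ over orthogonal $\mathbf O$. Second-order block. $\mathbf Q_{\mathrm{base}}=[(2-\delta_{j\ell})\,\partial_{\nu_j}\partial_{\nu_\ell}U(\boldsymbol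 0)]_{(j,\ell)\in\mathcal I}\in\mathbb R^{\mathcal M\times m}$ ($\delta_{j\ell}$ the Kronecker symbol), $\mathbf Q_0=\mathbf Q_{\mathrm{base}}\mathbf P_2$; $(\mathbf I-\Pi_0)\mathbf Q_{\mathrm{base}}$ has rank $m$. $\widehat{\mathbf U}_{(2)}^r$ (resp. $\mathbf U_{(2)}^*=[\boldsymbol\varphi_{q+1}^*,\dots,\boldsymbol\varphi_{q+m}^*]$) in $\mathbb R^{\mathcal M\times m}$ is the matrix of the first $m$ (orthonormal) left singular vectors of $\widehat{\mathbf S}^r=(\mathbf I-\Pi_0)\mathbf S^r$ (resp. of $(\mathbf I-\Pi_0)\mathbf Q_0$). $\mathbf O_{(2)}^r$ is an orthogonal $m\times m$ matrix with $\|\widehat{\mathbf U}_{(2)}^r-\mathbf U_{(2)}^*\mathbf O_{(2)}^r\|=\mathcal O(r)$; explicitly, it is the minimizer of $\|\widehat{\mathbf U}_{(2)}^r-\mathbf U_{(2)}^*\mathbf O\|_F$ over orthogonal $\mathbf O$. $\mathbf R\in\mathbb R^{m\times m}$ is given by $\mathbf R_{k,(j,\ell)}=\tfrac12(2-\delta_{j\ell})\langle\boldsymbol\varphi_{q+k}^*,(\mathbf I-\Pi_0)\partial_{\nu_j}\partial_{\nu_\ell}U(\boldsymbol 0)\rangle$ for $k=1,\dots,m$, $(j,\ell)\in\mathcal I$. Matrix norms are any sub-multiplicative unitarily invariant norm; the constants in $\mathcal O(\cdot)$ are independent of $r$ and $\boldsymbol\nu$, for $r$ sufficiently small. *)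

theory Defs
  imports "HOL-Analysis.Analysis"
begin

section \<open>Functions of class $C^k$ and embedded submanifolds\<close>

text \<open>Meant for open sets only: derivatives are taken at interior points.\<close>

primrec Ck_on :: "nat \<Rightarrow> ('a::euclidean_space \<Rightarrow> 'b::real_normed_vector) \<Rightarrow> 'a set \<Rightarrow> bool" where
  "Ck_on 0 f X \<longleftrightarrow> continuous_on X f"
| "Ck_on (Suc k) f X \<longleftrightarrow>
     (\<forall>x\<in>X. f differentiable (at x)) \<and> (\<forall>h. Ck_on k (\<lambda>x. frechet_derivative f (at x) h) X)"

definition partial :: "'q::finite \<Rightarrow> (real^'q \<Rightarrow> 'b::real_normed_vector) \<Rightarrow> real^'q \<Rightarrow> 'b" where
  "partial j f x = frechet_derivative f (at x) (axis j 1)"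

text \<open>Local flattening: near each of its points, the set is mapped onto an open piece of a
  $d$-dimensional linear subspace by an ambient $C^k$ diffeomorphism.\<close>

definition embedded_submanifold :: "nat \<Rightarrow> nat \<Rightarrow> 'a::euclidean_space set \<Rightarrow> bool" where
  "embedded_submanifold k d X \<longleftrightarrow>
     (\<forall>p\<in>X. \<exists>V W \<phi> \<psi> (L :: 'a set).
        open V \<and> p \<in> V \<and> open W \<and> homeomorphism V W \<phi> \<psi> \<and> Ck_on k \<phi> V \<and> Ck_on k \<psi> W \<and>
        subspace L \<and> dim L = d \<and> \<phi> ` (V \<inter> X) = W \<inter> L)"

text \<open>The component of a vector orthogonal to a linear subspace.\<close>

definition normal_component :: "'a::euclidean_space set \<Rightarrow> 'a \<Rightarrow> 'a" where
  "normal_component T x = (THE y. x - y \<in> T \<and> (\<forall>t\<in>T. orthogonal y t))"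


section \<open>The index set of the upper triangle\<close>

text \<open>The pairs $(j,l)$ with $j \le l$, ordered row by row, as a type; thus
  \<open>real ^ 'q upper\<close> is the space of vectors with $q(q+1)/2$ entries.\<close>

typedef (overloaded) ('q::linorder) upper = "{(j :: 'q, l :: 'q). j \<le> l}"
  morphisms pair_of Upper
  by auto

definition row_of :: "'q::linorder upper \<Rightarrow> 'q" where "row_of p = fst (pair_of p)"
definition col_of :: "'q::linorder upper \<Rightarrow> 'q" where "col_of p = snd (pair_of p)"

lemma row_of_le_col_of: "row_of p \<le> col_of p"
  using pair_of[of p] by (auto simp: row_of_def col_of_def)

lemma upper_eq_iff: "p = p' \<longleftrightarrow> row_of p = row_of p' \<and> col_of p = col_of p'"
  by (metis pair_of_inject prod_eq_iff row_of_def col_of_def)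

instantiation upper :: (linorder) linorder
begin

definition less_eq_upper :: "'a upper \<Rightarrow> 'a upper \<Rightarrow> bool" where
  "p \<le> p' \<longleftrightarrow> row_of p < row_of p' \<or> row_of p = row_of p' \<and> col_of p \<le> col_of p'"

definition less_upper :: "'a upper \<Rightarrow> 'a upper \<Rightarrow> bool" where
  "p < p' \<longleftrightarrow> row_of p < row_of p' \<or> row_of p = row_of p' \<and> col_of p < col_of p'"

instance
  by standard (auto simp: less_eq_upper_def less_upper_def upper_eq_iff)

end

instance upper :: ("{finite, linorder}") finite
proof
  have "inj (pair_of :: 'a upper \<Rightarrow> 'a \<times> 'a)"
    by (meson injI pair_of_inject)
  then show "finite (UNIV :: 'a upper set)"
    by (rule finite_imageD[rotated]) simp
qed

lemma card_upper: "CARD('q::{finite,linorder} upper) = CARD('q) * (CARD('q) + 1) div 2"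
proof -
  let ?U = "{(j :: 'q, l :: 'q). j \<le> l}" and ?L = "{(j :: 'q, l :: 'q). l \<le> j}"
  have "CARD('q upper) = card ?U"
    by (rule type_definition.card[OF type_definition_upper])
  moreover have "card ?L = card ?U"
    by (rule bij_betw_same_card[of prod.swap]) (auto simp: bij_betw_def inj_on_def image_iff)
  moreover have "card (?U \<union> ?L) + card (?U \<inter> ?L) = card ?U + card ?L"
    by (subst card_Un_Int) auto
  moreover have "?U \<union> ?L = UNIV"
    by auto
  moreover have "card (?U \<inter> ?L) = CARD('q)"
    by (rule bij_betw_same_card[of fst], rule bij_betwI[where g = "\<lambda>x. (x, x)"]) auto
  ultimately show ?thesis
    by (simp add: card_cartesian_product flip: UNIV_Times_UNIV)
qed

definition kronecker :: "'a \<Rightarrow> 'a \<Rightarrow> real" where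
  "kronecker j l = (if j = l then 1 else 0)"

definition vecsym :: "real^('q::{finite,linorder})^('q::{finite,linorder}) \<Rightarrow> real^('q::{finite,linorder} upper)" where
  "vecsym A = (\<chi> p. A $ row_of p $ col_of p)"

text \<open>The matrix $x y^\top$.\<close>

definition outer :: "real^'a \<Rightarrow> real^'b \<Rightarrow> real^'b^'a" where
  "outer x y = (\<chi> i j. x $ i * y $ j)"

definition matrix_of_columns :: "('k \<Rightarrow> real^'n) \<Rightarrow> real^'k^'n" where
  "matrix_of_columns c = (\<chi> i j. c j $ i)"

text \<open>Every component is a quadratic form.\<close>

definition homogeneous_quadratic :: "(real^'a \<Rightarrow> real^'b) \<Rightarrow> bool" where
  "homogeneous_quadratic f \<longleftrightarrow>
     (\<forall>k. \<exists>G :: real^'a^'a. transpose G = G \<and> (\<forall>x. f x $ k = x \<bullet> (G *v x)))"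


section \<open>Singular vectors\<close>

definition orthonormal_upto :: "nat \<Rightarrow> (nat \<Rightarrow> 'a::real_inner) \<Rightarrow> bool" where
  "orthonormal_upto d u \<longleftrightarrow> (\<forall>i<d. \<forall>j<d. u i \<bullet> u j = (if i = j then 1 else 0))"

text \<open>A full singular value decomposition, singular values in decreasing order;
  all families are numbered from 0.\<close>

definition is_svd ::
  "real^'s^'n \<Rightarrow> (nat \<Rightarrow> real^'n) \<Rightarrow> (nat \<Rightarrow> real) \<Rightarrow> (nat \<Rightarrow> real^'s) \<Rightarrow> bool" where
  "is_svd A u \<sigma> w \<longleftrightarrow>
     orthonormal_upto CARD('n) u \<and> orthonormal_upto CARD('s) w \<and>
     (\<forall>i < min CARD('n) CARD('s). 0 \<le> \<sigma> i) \<and>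
     (\<forall>i j. i \<le> j \<and> j < min CARD('n) CARD('s) \<longrightarrow> \<sigma> j \<le> \<sigma> i) \<and>
     A = (\<Sum>i < min CARD('n) CARD('s). \<sigma> i *\<^sub>R outer (u i) (w i))"

text \<open>The columns of \<open>V\<close> are, in the order of the index type \<open>'k\<close>, the first \<open>CARD('k)\<close> left
  singular vectors of \<open>A\<close> in some singular value decomposition. Singular vectors are not unique,
  hence a predicate.\<close>

definition first_left_singular_vectors :: "real^'s^'n \<Rightarrow> real^('k::{finite,linorder})^'n \<Rightarrow> bool" where
  "first_left_singular_vectors A V \<longleftrightarrow>
     CARD('k) \<le> CARD('n) \<and>
     (\<exists>u \<sigma> w. is_svd A u \<sigma> w \<and> (\<forall>k. column k V = u (card {i. i < k})))"

text \<open>\<open>Q\<close> is an orthogonal minimizer of the Frobenius norm of \<open>V - W Q\<close>; on matrices,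
  \<open>norm\<close> is the Frobenius norm.\<close>

definition procrustes_minimizer :: "real^'k^'n \<Rightarrow> real^'k^'n \<Rightarrow> real^'k^'k \<Rightarrow> bool" where
  "procrustes_minimizer V W Q \<longleftrightarrow>
     orthogonal_matrix Q \<and>
     (\<forall>Q'. orthogonal_matrix Q' \<longrightarrow> norm (V - W ** Q) \<le> norm (V - W ** Q'))"


section \<open>Matrices built from the parametrization\<close>

definition tangent_space :: "(real^'q \<Rightarrow> real^'n) \<Rightarrow> real^'q \<Rightarrow> (real^'n) set" where
  "tangent_space U \<nu> = range (\<lambda>x. jacobian U (at \<nu>) *v x)"

definition snapshot_matrix ::
  "(real^'q \<Rightarrow> real^'n) \<Rightarrow> real^'n \<Rightarrow> ('s \<Rightarrow> real^'q) \<Rightarrow> real \<Rightarrow> real^'s^'n" where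
  "snapshot_matrix U ustar nu r = matrix_of_columns (\<lambda>i. U (r *\<^sub>R nu i) - ustar)"

definition P2_matrix :: "('s \<Rightarrow> real^('q::{finite,linorder})) \<Rightarrow> real^'s^('q::{finite,linorder} upper)" where
  "P2_matrix nu = matrix_of_columns (\<lambda>i. vecsym (outer (nu i) (nu i)))"

definition Q_base :: "(real^('q::{finite,linorder}) \<Rightarrow> real^'n) \<Rightarrow> real^('q::{finite,linorder} upper)^'n" where
  "Q_base U = matrix_of_columns
     (\<lambda>p. (2 - kronecker (row_of p) (col_of p)) *\<^sub>R partial (row_of p) (partial (col_of p) U) 0)"

text \<open>Rows and columns are both indexed by \<open>'q upper\<close>: the $k$-th row belongs to the $k$-th
  column of \<open>U2s\<close>.\<close>

definition R_matrix ::
  "(real^('q::{finite,linorder}) \<Rightarrow> real^'n) \<Rightarrow> real^'n^'n \<Rightarrow> real^('q::{finite,linorder} upper)^'n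
     \<Rightarrow> real^('q::{finite,linorder} upper)^('q::{finite,linorder} upper)" where
  "R_matrix U Pi0 U2s = (\<chi> k p. (1/2) * (2 - kronecker (row_of p) (col_of p)) *
     (column k U2s \<bullet> ((mat 1 - Pi0) *v partial (row_of p) (partial (col_of p) U) 0)))"

end

theory Submission
  imports Defs
begin

text \<open>Write $v(\nu) = J\nu + \frac12 Q\,\mathrm{vecsym}(\nu\nu^\top) + O(\|\nu\|^3)$ with
  $J = J_U(0)$ and \<open>Q = Q_base U\<close>; this is Taylor's theorem, folded into the upper triangle
  by the symmetry of second derivatives (\<open>expansion_at_0\<close>). Sampling at the points $r\nu^i$ turns it into
  two statements about snapshots: $\frac1r S^r = JP + O(r)$, and, since the projection $I - \Pi_0$ kills the
  linear part, $\frac2{r^2}(I-\Pi_0)S^r = (I-\Pi_0)Q P_2 + O(r)$. Both limits have rank equal to the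
  number of singular vectors that are extracted, by the assumptions on the ranks of $J$, $P$, $P_2$ and of the
  second fundamental form.

  The perturbation lemma \<open>singular_vectors_perturbation\<close> then gives $U_{(1)}^r = U_{(1)}^* O_{(1)}^r + O(r)$ and
  $U_{(2)}^r = U_{(2)}^* O_{(2)}^r + O(r)$, and that the columns of $U_{(2)}^r$ lie in the range of $I - \Pi_0$.
  Its two halves are a lower bound on the leading singular values, which shows that the
  perturbed singular vectors are almost contained in the range of the limit matrix, and
  \<open>procrustes_bound\<close>: if the columns of $V$ are almost contained in the range of $W$, then the
  Procrustes minimizer $O$ makes $V - WO$ small.

  With these facts $B^r\alpha_{(1)}^r(\nu) = \nu + O(r\|\nu\|)$, so that $\|\nu\|$ and
  $\|\alpha_{(1)}^r(\nu)\|$ are comparable, while $\alpha_{(2)}^r(\nu) = U_{(2)}^{r\top}(I-\Pi_0)v(\nu)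
  = R^r\,\mathrm{vecsym}(\nu\nu^\top) + O(r\|\nu\|^2)$. Substituting the first relation into the second
  changes the quadratic term only by $O(r\|\nu\|^2)$.\<close>

section \<open>Partial derivatives and the second-order Taylor expansion\<close>

lemma norm_diff_le_of_derivative_bound:
  fixes \<phi> :: "real \<Rightarrow> 'b::real_normed_vector"
  assumes "0 \<le> t"
    and "\<And>s. \<lbrakk>0 \<le> s; s \<le> t\<rbrakk> \<Longrightarrow> (\<phi> has_vector_derivative \<phi>' s) (at s)"
    and "\<And>s. \<lbrakk>0 \<le> s; s \<le> t\<rbrakk> \<Longrightarrow> norm (\<phi>' s) \<le> b"
  shows "norm (\<phi> t - \<phi> 0) \<le> t * b"
proof -
  have "norm (\<phi> t - \<phi> 0) \<le> b * norm (t - 0)"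
  proof (rule differentiable_bound[of "{0..t}" \<phi> "\<lambda>s h. h *\<^sub>R \<phi>' s"])
    show "(\<phi> has_derivative (\<lambda>h. h *\<^sub>R \<phi>' s)) (at s within {0..t})" if "s \<in> {0..t}" for s
      using assms(2)[of s] that by (auto simp: has_vector_derivative_def intro: has_derivative_at_withinI)
    show "onorm (\<lambda>h. h *\<^sub>R \<phi>' s) \<le> b" if "s \<in> {0..t}" for s
    proof (rule onorm_bound)
      have le: "norm (\<phi>' s) \<le> b"
        using assms(3)[of s] that by simp
      then show "0 \<le> b"
        using norm_ge_zero order_trans by blast
      show "norm (h *\<^sub>R \<phi>' s) \<le> b * norm h" for h
        using mult_left_mono[OF le, of "norm h"] by (simp add: mult.commute)
    qed
  qed (use assms(1) in auto)
  then show ?thesis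
    using assms(1) by (simp add: mult.commute)
qed

text \<open>One half of the symmetry of second derivatives: the second difference of $f$ in the directions
  $d$ and $e$ is $t^2$ times $\partial_e\partial_d f$ up to the oscillation of that derivative. The
  difference itself does not depend on the order of the two directions.\<close>

lemma second_difference_bound:
  fixes f g h :: "'a::real_normed_vector \<Rightarrow> 'b::real_normed_vector"
  assumes t: "0 \<le> t"
    and fg: "\<And>s s'. \<lbrakk>0 \<le> s; s \<le> t; 0 \<le> s'; s' \<le> t\<rbrakk> \<Longrightarrow>
      ((\<lambda>s. f (x + s *\<^sub>R d + s' *\<^sub>R e)) has_vector_derivative g (x + s *\<^sub>R d + s' *\<^sub>R e)) (at s)"
    and gh: "\<And>s s'. \<lbrakk>0 \<le> s; s \<le> t; 0 \<le> s'; s' \<le> t\<rbrakk> \<Longrightarrow>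
      ((\<lambda>s'. g (x + s *\<^sub>R d + s' *\<^sub>R e)) has_vector_derivative h (x + s *\<^sub>R d + s' *\<^sub>R e)) (at s')"
    and bound: "\<And>s s'. \<lbrakk>0 \<le> s; s \<le> t; 0 \<le> s'; s' \<le> t\<rbrakk> \<Longrightarrow>
      norm (h (x + s *\<^sub>R d + s' *\<^sub>R e) - c) \<le> \<epsilon>"
  shows "norm (f (x + t *\<^sub>R d + t *\<^sub>R e) - f (x + t *\<^sub>R d) - f (x + t *\<^sub>R e) + f x - t\<^sup>2 *\<^sub>R c) \<le> t\<^sup>2 * \<epsilon>"
proof -
  define \<phi> where "\<phi> = (\<lambda>s. f (x + s *\<^sub>R d + t *\<^sub>R e) - f (x + s *\<^sub>R d + 0 *\<^sub>R e) - (s * t) *\<^sub>R c)"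
  have inner: "norm (g (x + s *\<^sub>R d + t *\<^sub>R e) - g (x + s *\<^sub>R d + 0 *\<^sub>R e) - t *\<^sub>R c) \<le> t * \<epsilon>"
    if "0 \<le> s" "s \<le> t" for s
  proof -
    have "((\<lambda>s'. g (x + s *\<^sub>R d + s' *\<^sub>R e) - s' *\<^sub>R c) has_vector_derivative
        h (x + s *\<^sub>R d + s' *\<^sub>R e) - c) (at s')" if "0 \<le> s'" "s' \<le> t" for s'
      using \<open>0 \<le> s\<close> \<open>s \<le> t\<close> that by (auto intro!: derivative_eq_intros gh)
    from norm_diff_le_of_derivative_bound[OF t this bound[OF that]] show ?thesis
      by (simp add: algebra_simps)
  qed
  have "norm (\<phi> t - \<phi> 0) \<le> t * (t * \<epsilon>)"
    using t inner unfolding \<phi>_def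
    by (intro norm_diff_le_of_derivative_bound)
      (auto intro!: derivative_eq_intros fg fg[where s' = 0, simplified] simp: mult.commute)
  then show ?thesis
    by (simp add: \<phi>_def power2_eq_square algebra_simps)
qed

lemma has_derivative_partial:
  fixes f :: "real^'q::finite \<Rightarrow> 'b::real_normed_vector"
  assumes "f differentiable (at x)"
  shows "(f has_derivative (\<lambda>h. \<Sum>j\<in>UNIV. h $ j *\<^sub>R partial j f x)) (at x)"
proof -
  let ?D = "frechet_derivative f (at x)"
  have D: "(f has_derivative ?D) (at x)"
    using assms by (simp add: frechet_derivative_works)
  then have "linear ?D"
    by (rule has_derivative_linear)
  have "?D h = (\<Sum>j\<in>UNIV. h $ j *\<^sub>R partial j f x)" for h
  proof -
    have "?D h = ?D (\<Sum>j\<in>UNIV. h $ j *\<^sub>R axis j 1)"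
      using basis_expansion[of h] by (simp add: scalar_mult_eq_scaleR)
    also have "\<dots> = (\<Sum>j\<in>UNIV. h $ j *\<^sub>R partial j f x)"
      using \<open>linear ?D\<close> by (simp add: linear_sum linear_scale partial_def)
    finally show ?thesis .
  qed
  then have "?D = (\<lambda>h. \<Sum>j\<in>UNIV. h $ j *\<^sub>R partial j f x)"
    by (rule ext)
  then show ?thesis
    using D by metis
qed

lemma jacobian_mult_eq_partial:
  fixes f :: "real^'q::finite \<Rightarrow> real^'n::finite"
  assumes "f differentiable (at x)"
  shows "jacobian f (at x) *v h = (\<Sum>j\<in>UNIV. h $ j *\<^sub>R partial j f x)"
  using has_derivative_unique[OF has_derivative_partial[OF assms] assms[unfolded jacobian_works]]
  by (simp add: fun_eq_iff)

lemma has_vector_derivative_along_line: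
  fixes f :: "real^'q::finite \<Rightarrow> 'b::real_normed_vector"
  assumes "f differentiable (at (x + s *\<^sub>R d))"
  shows "((\<lambda>s. f (x + s *\<^sub>R d)) has_vector_derivative
           (\<Sum>j\<in>UNIV. d $ j *\<^sub>R partial j f (x + s *\<^sub>R d))) (at s)"
proof -
  have "((\<lambda>s. x + s *\<^sub>R d) has_derivative (\<lambda>h. h *\<^sub>R d)) (at s)"
    by (auto intro!: derivative_eq_intros)
  from has_derivative_compose[OF this has_derivative_partial[OF assms]]
  show ?thesis
    by (simp add: has_vector_derivative_def scaleR_sum_right)
qed

lemma sum_axis_scaleR: "(\<Sum>l\<in>UNIV. (axis j 1 :: real^'q) $ l *\<^sub>R F l) = F j" for F :: "'q::finite \<Rightarrow> 'b::real_vector"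
proof -
  have "(\<Sum>l\<in>UNIV. (axis j 1 :: real^'q) $ l *\<^sub>R F l) = (\<Sum>l\<in>UNIV. if l = j then F l else 0)"
    by (rule sum.cong) (auto simp: axis_def)
  then show ?thesis
    by simp
qed

lemma Ck_on_partial: "Ck_on (Suc k) f X \<Longrightarrow> Ck_on k (partial j f) X"
proof -
  assume "Ck_on (Suc k) f X"
  moreover have "partial j f = (\<lambda>x. frechet_derivative f (at x) (axis j 1))"
    by (simp add: fun_eq_iff partial_def)
  ultimately show ?thesis
    by simp
qed

text \<open>Both mixed derivatives are the limit of the same second difference divided by $t^2$.\<close>

lemma partial_commute:
  fixes f :: "real^'q::finite \<Rightarrow> 'b::real_normed_vector"
  assumes X: "open X" "x \<in> X" and f: "Ck_on 2 f X"
  shows "partial j (partial l f) x = partial l (partial j f) x"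
proof -
  let ?H = "\<lambda>j l. partial j (partial l f)"
  have C1: "Ck_on 1 (partial l f) X" for l
    using f by (intro Ck_on_partial) (simp only: numeral_2_eq_2 One_nat_def)
  have C0: "continuous_on X (?H j l)" for j l
    using Ck_on_partial[of 0 "partial l f" X j] C1[of l] by simp
  have diff: "f differentiable (at y)" "partial l f differentiable (at y)" if "y \<in> X" for y l
    using f C1[of l] that by (auto simp: eval_nat_numeral)
  have "norm (?H j l x - ?H l j x) \<le> 0 + \<epsilon>" if "\<epsilon> > 0" for \<epsilon>
  proof -
    have "\<forall>\<^sub>F y in nhds x. y \<in> X \<and> dist (?H j l y) (?H j l x) < \<epsilon>/2 \<and> dist (?H l j y) (?H l j x) < \<epsilon>/2"
      using X C0 that
      by (intro eventually_conj eventually_nhds_in_open tendstoD)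
        (auto simp: continuous_on_eq_continuous_at isCont_def tendsto_at_iff_tendsto_nhds)
    then obtain \<delta> where "\<delta> > 0" and \<delta>: "\<And>y. dist y x < \<delta> \<Longrightarrow>
        y \<in> X \<and> dist (?H j l y) (?H j l x) < \<epsilon>/2 \<and> dist (?H l j y) (?H l j x) < \<epsilon>/2"
      unfolding eventually_nhds_metric by blast
    define t where "t = \<delta>/3"
    have t: "0 < t"
      using \<open>\<delta> > 0\<close> by (simp add: t_def)
    have near: "dist (x + s *\<^sub>R axis j 1 + s' *\<^sub>R axis l 1) x < \<delta>"
      if "0 \<le> s" "s \<le> t" "0 \<le> s'" "s' \<le> t" for s s' :: real and j l :: 'q
    proof -
      have "dist (x + s *\<^sub>R axis j 1 + s' *\<^sub>R axis l 1) x
          = norm (s *\<^sub>R (axis j 1 :: real^'q) + s' *\<^sub>R axis l 1)"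
        by (simp add: dist_norm add.assoc)
      also have "\<dots> \<le> norm (s *\<^sub>R (axis j 1 :: real^'q)) + norm (s' *\<^sub>R (axis l 1 :: real^'q))"
        by (rule norm_triangle_ineq)
      finally show ?thesis
        using that \<open>\<delta> > 0\<close> by (simp add: t_def norm_axis_1)
    qed
    have diff1: "((\<lambda>s. f (x + s *\<^sub>R axis a 1 + s' *\<^sub>R axis b 1)) has_vector_derivative
        partial a f (x + s *\<^sub>R axis a 1 + s' *\<^sub>R axis b 1)) (at s)"
      if "0 \<le> s" "s \<le> t" "0 \<le> s'" "s' \<le> t" for s s' :: real and a b :: 'q
    proof -
      have "x + s' *\<^sub>R axis b 1 + s *\<^sub>R axis a 1 \<in> X"
        using \<delta>[OF near[OF that, of a b]] by (simp add: algebra_simps)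
      from has_vector_derivative_along_line[OF diff(1)[OF this]] show ?thesis
        by (simp add: sum_axis_scaleR algebra_simps)
    qed
    have diff2: "((\<lambda>s'. partial a f (x + s *\<^sub>R axis a 1 + s' *\<^sub>R axis b 1)) has_vector_derivative
        partial b (partial a f) (x + s *\<^sub>R axis a 1 + s' *\<^sub>R axis b 1)) (at s')"
      if "0 \<le> s" "s \<le> t" "0 \<le> s'" "s' \<le> t" for s s' :: real and a b :: 'q
      using has_vector_derivative_along_line[of "partial a f" "x + s *\<^sub>R axis a 1" s' "axis b 1"]
        diff(2) \<delta>[OF near[OF that, of a b]]
      by (simp add: sum_axis_scaleR)
    let ?\<Delta> = "\<lambda>a b. f (x + t *\<^sub>R axis a 1 + t *\<^sub>R axis b 1) - f (x + t *\<^sub>R axis a 1) - f (x + t *\<^sub>R axis b 1) + f x"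
    have \<Delta>1: "norm (?\<Delta> l j - t\<^sup>2 *\<^sub>R ?H j l x) \<le> t\<^sup>2 * (\<epsilon>/2)"
      using t \<delta> near
      by (intro second_difference_bound[where g = "partial l f" and h = "?H j l"] diff1 diff2)
        (auto simp: dist_norm less_imp_le)
    have \<Delta>2: "norm (?\<Delta> j l - t\<^sup>2 *\<^sub>R ?H l j x) \<le> t\<^sup>2 * (\<epsilon>/2)"
      using t \<delta> near
      by (intro second_difference_bound[where g = "partial j f" and h = "?H l j"] diff1 diff2)
        (auto simp: dist_norm less_imp_le)
    have "norm ((?\<Delta> j l - t\<^sup>2 *\<^sub>R ?H l j x) - (?\<Delta> l j - t\<^sup>2 *\<^sub>R ?H j l x)) \<le> t\<^sup>2 * (\<epsilon>/2) + t\<^sup>2 * (\<epsilon>/2)"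
      by (rule order_trans[OF norm_triangle_ineq4 add_mono[OF \<Delta>2 \<Delta>1]])
    moreover have "(?\<Delta> j l - t\<^sup>2 *\<^sub>R ?H l j x) - (?\<Delta> l j - t\<^sup>2 *\<^sub>R ?H j l x) = t\<^sup>2 *\<^sub>R (?H j l x - ?H l j x)"
      by (simp add: algebra_simps)
    ultimately have "t\<^sup>2 * norm (?H j l x - ?H l j x) \<le> t\<^sup>2 * \<epsilon>"
      by (simp add: mult.commute)
    then show ?thesis
      using t by simp
  qed
  then have "norm (?H j l x - ?H l j x) \<le> 0"
    by (rule field_le_epsilon)
  then show ?thesis
    by simp
qed

text \<open>The crude constant (\<open>b\<close> rather than \<open>b / 6\<close>) allows three applications of the mean value
  inequality to replace the integral form of the remainder.\<close>

lemma second_order_Taylor_along_line: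
  fixes f f1 f2 f3 :: "real \<Rightarrow> 'b::real_normed_vector"
  assumes "\<And>s. \<lbrakk>0 \<le> s; s \<le> 1\<rbrakk> \<Longrightarrow> (f has_vector_derivative f1 s) (at s)"
    and "\<And>s. \<lbrakk>0 \<le> s; s \<le> 1\<rbrakk> \<Longrightarrow> (f1 has_vector_derivative f2 s) (at s)"
    and "\<And>s. \<lbrakk>0 \<le> s; s \<le> 1\<rbrakk> \<Longrightarrow> (f2 has_vector_derivative f3 s) (at s)"
    and bound: "\<And>s. \<lbrakk>0 \<le> s; s \<le> 1\<rbrakk> \<Longrightarrow> norm (f3 s) \<le> b"
  shows "norm (f 1 - f 0 - f1 0 - (1/2) *\<^sub>R f2 0) \<le> b"
proof -
  have "0 \<le> b"
    using order_trans[OF norm_ge_zero bound[of 0]] by simp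
  have le: "s * b \<le> b" if "0 \<le> s" "s \<le> 1" for s
    using that \<open>0 \<le> b\<close> mult_right_mono[of s 1 b] by simp
  have 2: "norm (f2 s - f2 0) \<le> b" if "0 \<le> s" "s \<le> 1" for s
    using norm_diff_le_of_derivative_bound[of s f2 f3 b] assms that le[OF that] by force
  have 1: "norm (f1 s - f1 0 - s *\<^sub>R f2 0) \<le> b" if "0 \<le> s" "s \<le> 1" for s
  proof -
    have "norm ((f1 s - s *\<^sub>R f2 0) - (f1 0 - 0 *\<^sub>R f2 0)) \<le> s * b"
      using that 2
      by (intro norm_diff_le_of_derivative_bound[where \<phi>' = "\<lambda>s. f2 s - f2 0"])
        (auto intro!: derivative_eq_intros assms)
    then show ?thesis
      using le[OF that] by (simp add: algebra_simps)
  qed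
  have "norm ((f 1 - 1 *\<^sub>R f1 0 - (1\<^sup>2 / 2) *\<^sub>R f2 0) - (f 0 - 0 *\<^sub>R f1 0 - (0\<^sup>2 / 2) *\<^sub>R f2 0)) \<le> 1 * b"
    using 1
    by (intro norm_diff_le_of_derivative_bound[where \<phi>' = "\<lambda>s. f1 s - f1 0 - s *\<^sub>R f2 0"])
      (auto intro!: derivative_eq_intros assms)
  then show ?thesis
    by (simp add: algebra_simps)
qed

lemma bounded_third_partials:
  fixes f :: "real^'q::finite \<Rightarrow> 'b::real_normed_vector"
  assumes K: "compact K" "K \<subseteq> X" and f: "Ck_on 3 f X"
  obtains b where "0 \<le> b" "\<And>i j l x. x \<in> K \<Longrightarrow> norm (partial i (partial j (partial l f)) x) \<le> b"
proof -
  let ?h = "\<lambda>(i, j, l). partial i (partial j (partial l f))"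
  have "\<exists>b. \<forall>x\<in>K. norm (?h p x) \<le> b" for p
  proof -
    obtain i j l where p: "p = (i, j, l)"
      by (cases p)
    have "Ck_on 0 (?h p) X"
      using f by (auto simp only: p numeral_3_eq_3 prod.case intro!: Ck_on_partial)
    then have "bounded (?h p ` K)"
      using K by (auto intro!: compact_imp_bounded compact_continuous_image intro: continuous_on_subset)
    then show ?thesis
      by (auto simp: bounded_iff)
  qed
  then obtain b where b: "\<And>p x. x \<in> K \<Longrightarrow> norm (?h p x) \<le> b p"
    by metis
  show thesis
  proof (rule that)
    show "0 \<le> (\<Sum>p\<in>UNIV. \<bar>b p\<bar>)"
      by (simp add: sum_nonneg)
    show "norm (partial i (partial j (partial l f)) x) \<le> (\<Sum>p\<in>UNIV. \<bar>b p\<bar>)" if "x \<in> K" for i j l x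
    proof -
      have "norm (partial i (partial j (partial l f)) x) \<le> \<bar>b (i, j, l)\<bar>"
        using b[OF that, of "(i, j, l)"] by simp
      also have "\<dots> \<le> (\<Sum>p\<in>UNIV. \<bar>b p\<bar>)"
        by (rule member_le_sum) auto
      finally show ?thesis .
    qed
  qed
qed

lemma second_order_Taylor:
  fixes f :: "real^'q::finite \<Rightarrow> 'b::real_normed_vector"
  assumes X: "cball 0 1 \<subseteq> X" and f: "Ck_on 3 f X"
  obtains b where "0 \<le> b" "\<And>x. x \<in> cball 0 1 \<Longrightarrow>
    norm (f x - f 0 - (\<Sum>j\<in>UNIV. x $ j *\<^sub>R partial j f 0)
      - (1/2) *\<^sub>R (\<Sum>j\<in>UNIV. \<Sum>l\<in>UNIV. (x $ j * x $ l) *\<^sub>R partial l (partial j f) 0)) \<le> b * norm x ^ 3"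
proof -
  obtain b where b: "0 \<le> b" "\<And>i j l x. x \<in> cball 0 1 \<Longrightarrow> norm (partial i (partial j (partial l f)) x) \<le> b"
    using bounded_third_partials[OF compact_cball X f] by metis
  have diff: "f differentiable (at y)" "partial j f differentiable (at y)"
    "partial l (partial j f) differentiable (at y)" if "y \<in> cball 0 1" for y j l
  proof -
    have "y \<in> X"
      using X that by auto
    moreover have "Ck_on 2 (partial j f) X" "Ck_on 1 (partial l (partial j f)) X"
      using f by (auto simp only: numeral_2_eq_2 numeral_3_eq_3 One_nat_def intro!: Ck_on_partial)
    ultimately show "f differentiable (at y)" "partial j f differentiable (at y)"
      "partial l (partial j f) differentiable (at y)"
      using f by (simp_all add: eval_nat_numeral)
  qed
  define n where "n = real CARD('q)"
  have "norm (f x - f 0 - (\<Sum>j\<in>UNIV. x $ j *\<^sub>R partial j f 0)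
      - (1/2) *\<^sub>R (\<Sum>j\<in>UNIV. \<Sum>l\<in>UNIV. (x $ j * x $ l) *\<^sub>R partial l (partial j f) 0))
      \<le> (n ^ 3 * b) * norm x ^ 3" (is "norm ?r \<le> _") if x: "x \<in> cball 0 1" for x
  proof -
    define f0 f1 f2 f3 where "f0 = (\<lambda>s. f (s *\<^sub>R x))"
      and "f1 = (\<lambda>s. \<Sum>j\<in>UNIV. x $ j *\<^sub>R partial j f (s *\<^sub>R x))"
      and "f2 = (\<lambda>s. \<Sum>j\<in>UNIV. x $ j *\<^sub>R (\<Sum>l\<in>UNIV. x $ l *\<^sub>R partial l (partial j f) (s *\<^sub>R x)))"
      and "f3 = (\<lambda>s. \<Sum>j\<in>UNIV. x $ j *\<^sub>R (\<Sum>l\<in>UNIV. x $ l *\<^sub>R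
            (\<Sum>i\<in>UNIV. x $ i *\<^sub>R partial i (partial l (partial j f)) (s *\<^sub>R x))))"
    have in_ball: "s *\<^sub>R x \<in> cball 0 1" if "0 \<le> s" "s \<le> 1" for s
      using that x mult_mono[of s 1 "norm x" 1] by simp
    have line: "((\<lambda>s. g (s *\<^sub>R x)) has_vector_derivative (\<Sum>j\<in>UNIV. x $ j *\<^sub>R partial j g (s *\<^sub>R x))) (at s)"
      if "g differentiable (at (s *\<^sub>R x))" for g :: "real^'q \<Rightarrow> 'b" and s
      using has_vector_derivative_along_line[of g 0 s x] that by simp
    have coeff: "norm (x $ j *\<^sub>R y) \<le> norm x * c" if "norm y \<le> c" for j c and y :: 'b
      using that component_le_norm_cart[of x j] by (simp add: mult_mono)
    have scaleR_const: "((\<lambda>s. a *\<^sub>R g s) has_vector_derivative a *\<^sub>R g') (at s)"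
      if "(g has_vector_derivative g') (at s)" for a s g' and g :: "real \<Rightarrow> 'b"
      using that by (auto intro!: derivative_eq_intros)
    have sum_le: "norm (\<Sum>j\<in>UNIV. y j) \<le> n * c" if "\<And>j. norm (y j) \<le> c" for y :: "'q \<Rightarrow> 'b" and c
      using norm_sum[of y UNIV] sum_bounded_above[of UNIV "\<lambda>j. norm (y j)" c] that by (simp add: n_def)
    have "norm (f0 1 - f0 0 - f1 0 - (1/2) *\<^sub>R f2 0) \<le> n * (norm x * (n * (norm x * (n * (norm x * b)))))"
    proof (rule second_order_Taylor_along_line[where ?f3.0 = f3])
      fix s :: real assume "0 \<le> s" "s \<le> 1"
      note s = in_ball[OF this]
      show "(f0 has_vector_derivative f1 s) (at s)"
        unfolding f0_def f1_def using s by (intro line diff)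
      show "(f1 has_vector_derivative f2 s) (at s)"
        unfolding f1_def f2_def using s
        by (intro has_vector_derivative_sum scaleR_const line diff)
      show "(f2 has_vector_derivative f3 s) (at s)"
        unfolding f2_def f3_def using s
        by (intro has_vector_derivative_sum scaleR_const line diff)
      show "norm (f3 s) \<le> n * (norm x * (n * (norm x * (n * (norm x * b)))))"
        unfolding f3_def using s by (intro sum_le coeff b)
    qed
    moreover have "f0 1 - f0 0 - f1 0 - (1/2) *\<^sub>R f2 0 = ?r"
      by (simp add: f0_def f1_def f2_def scaleR_sum_right)
    moreover have "n * (norm x * (n * (norm x * (n * (norm x * b))))) = (n ^ 3 * b) * norm x ^ 3"
      by (simp add: power3_eq_cube mult_ac)
    ultimately show ?thesis
      by (simp only:)
  qed
  moreover have "0 \<le> n ^ 3 * b"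
    using b by (simp add: n_def)
  ultimately show thesis
    by (rule that[rotated])
qed

section \<open>Matrices acting on Euclidean space\<close>

text \<open>Products with a transpose are kept in the form \<open>transpose A *v x\<close>, so that they match
  \<open>matrix_vector_mul_assoc\<close> and the equation \<open>transpose V ** V = mat 1\<close> for orthonormal columns.\<close>

declare transpose_matrix_vector [simp del]

lemma inner_matrix_vector_mult: "(A *v x) \<bullet> y = x \<bullet> (transpose A *v y)"
  for A :: "real^'n::finite^'m::finite"
  by (metis dot_lmul_matrix inner_commute vector_transpose_matrix)

lemma norm_transpose_mult_le:
  fixes A :: "real^'n::finite^'m::finite"
  assumes "\<And>x. norm (A *v x) \<le> b * norm x"
  shows "norm (transpose A *v y) \<le> b * norm y"
proof -
  have "norm (transpose A *v y) * norm (transpose A *v y) = (A *v (transpose A *v y)) \<bullet> y"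
    by (simp add: inner_matrix_vector_mult flip: power2_norm_eq_inner power2_eq_square)
  also have "\<dots> \<le> norm (A *v (transpose A *v y)) * norm y"
    by (rule norm_cauchy_schwarz)
  also have "\<dots> \<le> (b * norm (transpose A *v y)) * norm y"
    by (intro mult_right_mono assms) auto
  finally have "norm (transpose A *v y) * norm (transpose A *v y) \<le> norm (transpose A *v y) * (b * norm y)"
    by (simp add: mult_ac)
  moreover have "0 \<le> b * norm y"
    using order_trans[OF norm_ge_zero assms[of "axis undefined 1"]] by (simp add: norm_axis_1)
  ultimately show ?thesis
    by (cases "transpose A *v y = 0") auto
qed

lemma norm_matrix_mult_le_of_columns:
  fixes A :: "real^'n::finite^'m::finite"
  assumes "\<And>i. norm (column i A) \<le> b"
  shows "norm (A *v x) \<le> real CARD('n) * b * norm x"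
proof -
  have "norm (A *v x) \<le> (\<Sum>i\<in>UNIV. norm (x $ i *s column i A))"
    unfolding matrix_mult_sum by (rule norm_sum)
  also have "\<dots> \<le> (\<Sum>i\<in>(UNIV :: 'n set). norm x * b)"
    by (intro sum_mono) (simp add: scalar_mult_eq_scaleR mult_mono component_le_norm_cart assms)
  finally show ?thesis
    by (simp add: mult_ac)
qed

lemma norm_mult_orthonormal_columns:
  fixes V :: "real^'k::finite^'n::finite"
  assumes "transpose V ** V = mat 1"
  shows "norm (V *v x) = norm x"
proof -
  have "(V *v x) \<bullet> (V *v x) = x \<bullet> x"
    by (simp add: inner_matrix_vector_mult matrix_vector_mul_assoc assms)
  then show ?thesis
    by (simp add: norm_eq)
qed

lemma norm_transpose_mult_orthonormal_columns:
  fixes V :: "real^'k::finite^'n::finite"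
  assumes "transpose V ** V = mat 1"
  shows "norm (transpose V *v y) \<le> norm y"
  using norm_transpose_mult_le[of V 1 y] norm_mult_orthonormal_columns[OF assms] by simp

section \<open>Leading singular values and left singular vectors\<close>

lemma outer_mult: "outer a b *v x = (b \<bullet> x) *\<^sub>R a"
  by (simp add: vec_eq_iff matrix_vector_mult_def outer_def inner_vec_def sum_distrib_left mult_ac)

lemma transpose_outer: "transpose (outer a b) = outer b a"
  by (vector transpose_def outer_def mult.commute)

lemma matrix_vector_mult_sum: "sum F I *v x = (\<Sum>i\<in>I. F i *v x)"
  for F :: "_ \<Rightarrow> real^'n::finite^'m::finite"
  by (induction I rule: infinite_finite_induct) (auto simp: matrix_vector_mult_add_rdistrib)

lemma transpose_sum: "transpose (sum F I) = (\<Sum>i\<in>I. transpose (F i))"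
  for F :: "_ \<Rightarrow> real^'n::finite^'m::finite"
  by (simp add: transpose_def vec_eq_iff)

lemma transpose_scaleR: "transpose (c *\<^sub>R A) = c *\<^sub>R transpose A"
  for A :: "real^'n::finite^'m::finite"
  by (vector transpose_def)

lemma svd_mult:
  fixes A :: "real^'s::finite^'n::finite"
  assumes svd: "is_svd A u \<sigma> w" and i: "i < CARD('n)" "i < CARD('s)"
  shows "A *v w i = \<sigma> i *\<^sub>R u i" "transpose A *v u i = \<sigma> i *\<^sub>R w i"
proof -
  let ?m = "min CARD('n) CARD('s)"
  have A: "A = (\<Sum>j<?m. \<sigma> j *\<^sub>R outer (u j) (w j))"
    and u: "\<And>j. j < ?m \<Longrightarrow> u j \<bullet> u i = (if j = i then 1 else 0)"
    and w: "\<And>j. j < ?m \<Longrightarrow> w j \<bullet> w i = (if j = i then 1 else 0)"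
    using svd i by (auto simp: is_svd_def orthonormal_upto_def)
  have "A *v w i = (\<Sum>j<?m. if j = i then \<sigma> j *\<^sub>R u j else 0)"
    unfolding A by (subst matrix_vector_mult_sum, rule sum.cong)
      (auto simp: w outer_mult scaleR_matrix_vector_assoc[symmetric])
  then show "A *v w i = \<sigma> i *\<^sub>R u i"
    using i by simp
  have "transpose A *v u i = (\<Sum>j<?m. if j = i then \<sigma> j *\<^sub>R w j else 0)"
    unfolding A by (subst transpose_sum, subst matrix_vector_mult_sum, rule sum.cong)
      (auto simp: u outer_mult scaleR_matrix_vector_assoc[symmetric] transpose_scaleR transpose_outer)
  then show "transpose A *v u i = \<sigma> i *\<^sub>R w i"
    using i by simp
qed

text \<open>The map $y \mapsto \sum_{z \in F} \langle z, y\rangle z$ sends the subspace into the span of \<open>F\<close>,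
  of smaller dimension, so it has a kernel there, and a vector in the kernel is orthogonal to every element of \<open>F\<close>.\<close>

lemma ex_nonzero_orthogonal_in_subspace:
  fixes X :: "'a::euclidean_space set"
  assumes X: "subspace X" and F: "finite F" "card F < dim X"
  obtains y where "y \<in> X" "y \<noteq> 0" "\<And>z. z \<in> F \<Longrightarrow> z \<bullet> y = 0"
proof -
  define f where "f = (\<lambda>y. \<Sum>z\<in>F. (z \<bullet> y) *\<^sub>R z)"
  have f: "linear f"
    unfolding f_def by (intro linear_compose_sum ballI linearI) (auto simp: inner_add_right scaleR_add_left)
  have "f ` X \<subseteq> span F"
    unfolding f_def by (intro image_subsetI span_sum span_scale span_base)
  then have "dim (f ` X) \<le> card F"
    using F(1) by (metis dim_le_card)
  then have "\<not> inj_on f X"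
    using dim_image_eq[OF f, of X] F(2) by (auto simp: span_eq_iff[THEN iffD2, OF X])
  then obtain y where y: "y \<in> X" "y \<noteq> 0" "f y = 0"
    using linear_inj_on_iff_eq_0[OF f X] by blast
  have "(\<Sum>z\<in>F. (z \<bullet> y)\<^sup>2) = f y \<bullet> y"
    by (simp add: f_def inner_sum_left power2_eq_square)
  then have "\<forall>z\<in>F. (z \<bullet> y)\<^sup>2 = 0"
    using y(3) F(1) by (simp add: sum_nonneg_eq_0_iff)
  then show thesis
    using y by (intro that[of y]) auto
qed

lemma orthonormal_upto_Bessel:
  assumes "orthonormal_upto d u"
  shows "(\<Sum>j<d. (u j \<bullet> y)\<^sup>2) \<le> (norm y)\<^sup>2"
proof -
  define p where "p = (\<Sum>j<d. (u j \<bullet> y) *\<^sub>R u j)"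
  have "u i \<bullet> p = u i \<bullet> y" if "i < d" for i
  proof -
    have "u i \<bullet> p = (\<Sum>j<d. if i = j then u j \<bullet> y else 0)"
      unfolding p_def inner_sum_right using assms that
      by (intro sum.cong) (auto simp: orthonormal_upto_def)
    then show ?thesis
      using that by simp
  qed
  then have "p \<bullet> p = (\<Sum>j<d. (u j \<bullet> y)\<^sup>2)" "p \<bullet> y = (\<Sum>j<d. (u j \<bullet> y)\<^sup>2)"
    by (subst p_def, simp add: inner_sum_left power2_eq_square)
      (simp add: p_def inner_sum_left power2_eq_square)
  moreover have "0 \<le> (y - p) \<bullet> (y - p)"
    by simp
  ultimately show ?thesis
    by (simp add: power2_norm_eq_inner inner_diff_left inner_diff_right inner_commute)
qed

text \<open>The easy half of the Courant-Fischer principle: the subspace contains a vector orthogonal to the first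
  $i$ left singular vectors, and $A^\top$ stretches such a vector by at most $\sigma_i$.\<close>

lemma singular_value_lower_bound:
  fixes A :: "real^'s::finite^'n::finite"
  assumes svd: "is_svd A u \<sigma> w" and X: "subspace X" "i < dim X"
    and c: "0 \<le> c" "\<And>y. y \<in> X \<Longrightarrow> c * norm y \<le> norm (transpose A *v y)"
    and i: "i < CARD('n)" "i < CARD('s)"
  shows "c \<le> \<sigma> i"
proof -
  let ?m = "min CARD('n) CARD('s)"
  have A: "A = (\<Sum>j<?m. \<sigma> j *\<^sub>R outer (u j) (w j))"
    and u: "orthonormal_upto ?m u" and w: "orthonormal_upto ?m w"
    and \<sigma>: "\<And>j. j < ?m \<Longrightarrow> 0 \<le> \<sigma> j" "\<And>j. i \<le> j \<Longrightarrow> j < ?m \<Longrightarrow> \<sigma> j \<le> \<sigma> i"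
    using svd i by (auto simp: is_svd_def orthonormal_upto_def)
  have "card (u ` {..<i}) < dim X"
    using card_image_le[of "{..<i}" u] X(2) by simp
  then obtain y where y: "y \<in> X" "y \<noteq> 0" "\<And>j. j < i \<Longrightarrow> u j \<bullet> y = 0"
    by (rule ex_nonzero_orthogonal_in_subspace[OF X(1) finite_imageI[OF finite_lessThan]]) blast
  define z where "z = transpose A *v y"
  have z: "z = (\<Sum>j<?m. (\<sigma> j * (u j \<bullet> y)) *\<^sub>R w j)"
    unfolding z_def A transpose_sum matrix_vector_mult_sum
    by (simp add: transpose_scaleR transpose_outer outer_mult scaleR_matrix_vector_assoc[symmetric])
  have "w j \<bullet> z = \<sigma> j * (u j \<bullet> y)" if "j < ?m" for j
  proof -
    have "w j \<bullet> z = (\<Sum>l<?m. if j = l then \<sigma> l * (u l \<bullet> y) else 0)"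
      unfolding z inner_sum_right using w that
      by (intro sum.cong) (auto simp: orthonormal_upto_def)
    then show ?thesis
      using that by simp
  qed
  then have "z \<bullet> z = (\<Sum>j<?m. (\<sigma> j)\<^sup>2 * (u j \<bullet> y)\<^sup>2)"
    by (subst z, simp add: inner_sum_left power2_eq_square mult_ac)
  also have "\<dots> \<le> (\<Sum>j<?m. (\<sigma> i)\<^sup>2 * (u j \<bullet> y)\<^sup>2)"
  proof (rule sum_mono)
    fix j assume j: "j \<in> {..<?m}"
    show "(\<sigma> j)\<^sup>2 * (u j \<bullet> y)\<^sup>2 \<le> (\<sigma> i)\<^sup>2 * (u j \<bullet> y)\<^sup>2"
      using y(3)[of j] \<sigma>(1)[of j] \<sigma>(2)[of j] j
      by (cases "j < i") (auto intro!: mult_right_mono power_mono)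
  qed
  also have "\<dots> \<le> (\<sigma> i)\<^sup>2 * (norm y)\<^sup>2"
    using orthonormal_upto_Bessel[OF u] by (simp add: mult_left_mono flip: sum_distrib_left)
  finally have "(norm z)\<^sup>2 \<le> (\<sigma> i * norm y)\<^sup>2"
    by (simp add: power2_norm_eq_inner power_mult_distrib)
  then have "norm z \<le> \<sigma> i * norm y"
    by (rule power2_le_imp_le) (use \<sigma>(1) i in auto)
  then have "c * norm y \<le> \<sigma> i * norm y"
    using c(2)[OF y(1)] by (simp add: z_def)
  then show ?thesis
    using y(2) by simp
qed

text \<open>Singular vectors are assigned to columns by counting the predecessors of the column index.\<close>

lemma column_numbering_inj:
  fixes k k' :: "'k::{finite,linorder}"
  assumes "card {l. l < k} = card {l. l < k'}"
  shows "k = k'"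
proof (rule ccontr)
  assume "k \<noteq> k'"
  then have "{l. l < k} \<subset> {l. l < k'} \<or> {l. l < k'} \<subset> {l. l < k}"
    by (cases k k' rule: linorder_cases) auto
  then show False
    using assms psubset_card_mono[OF finite[of "{l. l < k}"], of "{l. l < k'}"]
      psubset_card_mono[OF finite[of "{l. l < k'}"], of "{l. l < k}"] by auto
qed

lemma column_numbering_less: "card {l. l < k} < CARD('k)" for k :: "'k::{finite,linorder}"
  by (rule psubset_card_mono) auto

lemma first_left_singular_vectors_orthonormal:
  fixes V :: "real^'k::{finite,linorder}^'n::finite"
  assumes "first_left_singular_vectors A V"
  shows "transpose V ** V = mat 1"
proof -
  obtain u where u: "orthonormal_upto CARD('n) u" "\<And>k. column k V = u (card {i. i < k})"
    and le: "CARD('k) \<le> CARD('n)"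
    using assms unfolding first_left_singular_vectors_def is_svd_def by blast
  have "column j V \<bullet> column k V = (if j = k then 1 else 0)" for j k
  proof -
    have "card {i. i < j} < CARD('n)" "card {i. i < k} < CARD('n)"
      using column_numbering_less[of j] column_numbering_less[of k] le by linarith+
    then show ?thesis
      using u(1) column_numbering_inj[of j k] unfolding orthonormal_upto_def u(2) by metis
  qed
  then show ?thesis
    by (simp add: vec_eq_iff matrix_mult_transpose_dot_column mat_def)
qed

text \<open>From $T w_i = \sigma_i u_i$: a leading left singular vector is the image of $w_i/\sigma_i$, whose
  norm is controlled because $\sigma_i$ is bounded away from zero.\<close>

lemma first_left_singular_vectors_preimage:
  fixes T :: "real^'s::finite^'n::finite" and V :: "real^'k::{finite,linorder}^'n"
  assumes V: "first_left_singular_vectors T V" and s: "CARD('k) \<le> CARD('s)"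
    and X: "subspace X" "CARD('k) \<le> dim X"
    and c: "0 < c" "\<And>y. y \<in> X \<Longrightarrow> c * norm y \<le> norm (transpose T *v y)"
  obtains x where "norm x \<le> 1 / c" "column k V = T *v x"
proof -
  obtain u \<sigma> w where svd: "is_svd T u \<sigma> w" and u: "column k V = u (card {i. i < k})"
    and le: "CARD('k) \<le> CARD('n)"
    using V unfolding first_left_singular_vectors_def by blast
  define i where "i = card {i. i < k}"
  have i: "i < CARD('k)"
    by (simp add: i_def column_numbering_less)
  have \<sigma>: "c \<le> \<sigma> i"
    using i le s X c by (intro singular_value_lower_bound[OF svd X(1)]) auto
  have "w i \<bullet> w i = 1"
    using svd i s by (auto simp: is_svd_def orthonormal_upto_def)
  then have "norm (w i) = 1"
    by (simp add: norm_eq_1)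
  then have "norm ((1 / \<sigma> i) *\<^sub>R w i) \<le> 1 / c"
    using c(1) \<sigma> by (simp add: frac_le)
  moreover have "column k V = T *v ((1 / \<sigma> i) *\<^sub>R w i)"
    using svd_mult(1)[OF svd, of i] i le s c(1) \<sigma> by (simp add: u matrix_vector_mult_scaleR flip: i_def)
  ultimately show thesis
    by (rule that)
qed

lemma transpose_bounded_below_on_range:
  fixes A :: "real^'s::finite^'n::finite"
  obtains c where "0 < c" "\<And>y. y \<in> range ((*v) A) \<Longrightarrow> c * norm y \<le> norm (transpose A *v y)"
proof -
  have sub: "subspace (range ((*v) A))"
    by (simp add: linear_subspace_image)
  have "A *v x = 0" if "transpose A *v (A *v x) = 0" for x
    using inner_matrix_vector_mult[of A x "A *v x"] that by simp
  then show thesis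
    using injective_imp_isometric[OF closed_subspace[OF sub] sub matrix_vector_mul_bounded_linear, of "transpose A"] that
    by auto
qed

lemma rank_le_columns: "rank A \<le> CARD('s)"
  for A :: "real^'s::finite^'n::finite"
  using rank_bound[of A] by auto

text \<open>When exactly \<open>rank A\<close> singular vectors are taken, the corresponding singular values are
  nonzero, so the singular vectors lie in the range of \<open>A\<close>; they span it by counting dimensions.\<close>

lemma first_left_singular_vectors_range:
  fixes A :: "real^'s::finite^'n::finite" and W :: "real^'k::{finite,linorder}^'n"
  assumes W: "first_left_singular_vectors A W" and rank: "rank A = CARD('k)"
  shows "range ((*v) W) = range ((*v) A)"
proof -
  have sub: "subspace (range ((*v) B))" for B :: "real^'j::finite^'n"
    by (simp add: linear_subspace_image)
  have s: "CARD('k) \<le> CARD('s)"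
    using rank_le_columns[of A] rank by simp
  obtain c where c: "0 < c" "\<And>y. y \<in> range ((*v) A) \<Longrightarrow> c * norm y \<le> norm (transpose A *v y)"
    using transpose_bounded_below_on_range by blast
  have dimA: "dim (range ((*v) A)) = CARD('k)"
    using rank by (simp add: rank_dim_range)
  have col: "column k W \<in> range ((*v) A)" for k
  proof -
    obtain x where "column k W = A *v x"
      by (rule first_left_singular_vectors_preimage[OF W s sub[of A] _ c]) (simp_all add: dimA)
    then show ?thesis
      by simp
  qed
  have "W *v z \<in> range ((*v) A)" for z
    unfolding matrix_mult_sum[of W] scalar_mult_eq_scaleR
    by (intro subspace_sum[OF sub] subspace_scale[OF sub] col)
  then have "range ((*v) W) \<subseteq> range ((*v) A)"
    by auto
  moreover have orth: "transpose W ** W = mat 1"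
    by (rule first_left_singular_vectors_orthonormal[OF W])
  then have "rank W = CARD('k)"
    unfolding full_rank_injective matrix_left_invertible_injective[symmetric] by (rule exI)
  then have "dim (range ((*v) A)) \<le> dim (range ((*v) W))"
    using dimA by (simp add: rank_dim_range)
  ultimately show ?thesis
    by (intro subspace_dim_equal sub)
qed

lemma orthonormal_columns_projection:
  fixes W :: "real^'k::finite^'n::finite"
  assumes "transpose W ** W = mat 1" "y \<in> range ((*v) W)"
  shows "W *v (transpose W *v y) = y"
proof -
  obtain z where "y = W *v z"
    using assms(2) by blast
  then show ?thesis
    by (simp add: matrix_vector_mul_assoc[of "transpose W" W] assms(1))
qed

lemma norm_orthogonal_complement_le:
  fixes W :: "real^'k::finite^'n::finite"
  assumes "transpose W ** W = mat 1"
  shows "norm (y - W *v (transpose W *v y)) \<le> norm y"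
proof -
  let ?p = "W *v (transpose W *v y)"
  have "?p \<bullet> ?p = ?p \<bullet> y"
    by (simp add: inner_matrix_vector_mult matrix_vector_mul_assoc[of "transpose W" W] assms)
  then have "(y - ?p) \<bullet> (y - ?p) = y \<bullet> y - ?p \<bullet> ?p"
    by (simp add: inner_diff_left inner_diff_right inner_commute)
  then show ?thesis
    by (simp add: norm_le)
qed

lemma first_left_singular_vectors_scaleR:
  fixes A :: "real^'s::finite^'n::finite"
  assumes "first_left_singular_vectors A V" "0 < c"
  shows "first_left_singular_vectors (c *\<^sub>R A) V"
proof -
  have "is_svd (c *\<^sub>R A) u (\<lambda>i. c * \<sigma> i) w" if "is_svd A u \<sigma> w" for u \<sigma> w
    using that assms(2) by (auto simp: is_svd_def scaleR_sum_right)
  then show ?thesis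
    using assms(1) unfolding first_left_singular_vectors_def by blast
qed

section \<open>The orthogonal Procrustes problem\<close>

lemma inner_matrix_columns: "A \<bullet> B = (\<Sum>k\<in>UNIV. column k A \<bullet> column k B)"
  for A B :: "real^'k::finite^'n::finite"
  unfolding inner_vec_def column_def by (simp add: sum.swap[of _ "UNIV :: 'n set"])

lemma column_matrix_mult: "column k (B ** C) = B *v column k C"
  for B :: "real^'a::finite^'b::finite" and C :: "real^'c::finite^'a"
  by (simp add: vec_eq_iff column_def matrix_matrix_mult_def matrix_vector_mult_def)

lemma inner_matrix_mult: "A \<bullet> (B ** C) = (transpose B ** A) \<bullet> C"
  for A :: "real^'k::finite^'n::finite" and B :: "real^'j::finite^'n"
proof -
  have "A \<bullet> (B ** C) = (\<Sum>k\<in>UNIV. (transpose B *v column k A) \<bullet> column k C)"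
    by (simp add: inner_matrix_columns column_matrix_mult inner_matrix_vector_mult)
  then show ?thesis
    by (simp add: inner_matrix_columns column_matrix_mult)
qed

lemma inner_matrix_outer: "A \<bullet> outer x y = x \<bullet> (A *v y)"
  for A :: "real^'k::finite^'n::finite"
  by (simp add: inner_vec_def outer_def matrix_vector_mult_def sum_distrib_left mult_ac)

text \<open>As all matrices $W Q'$ with orthogonal $Q'$ have the same Frobenius norm, minimizing
  $\|V - W Q'\|$ means maximizing $\langle V, W Q'\rangle$. Relative to the minimizer, this says that
  the identity maximizes the inner product with $N = (W Q)^\top V$ over the orthogonal matrices.\<close>

lemma procrustes_minimizer_optimal:
  fixes V W :: "real^'k::finite^'n::finite"
  assumes Q: "procrustes_minimizer V W Q" and W: "transpose W ** W = mat 1" and H: "orthogonal_matrix H"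
  defines "N \<equiv> transpose (W ** Q) ** V"
  shows "N \<bullet> H \<le> N \<bullet> mat 1"
proof -
  have orth: "transpose (W ** Q') ** (W ** Q') = mat 1" if "orthogonal_matrix Q'" for Q'
    using that W by (metis matrix_mul_assoc matrix_mul_rid matrix_transpose_mul orthogonal_matrix_def)
  have "(W ** Q') \<bullet> (W ** Q') = mat 1 \<bullet> (mat 1 :: real^'k^'k)" if "orthogonal_matrix Q'" for Q'
    using inner_matrix_mult[of "W ** Q'" "W ** Q'" "mat 1"] orth[OF that] by simp
  then have norm: "(norm (V - W ** Q'))\<^sup>2 = V \<bullet> V - 2 * (V \<bullet> (W ** Q')) + mat 1 \<bullet> (mat 1 :: real^'k^'k)"
    if "orthogonal_matrix Q'" for Q'
    using that by (simp add: power2_norm_eq_inner inner_diff_left inner_diff_right inner_commute)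
  have oQ: "orthogonal_matrix Q" "orthogonal_matrix (Q ** H)"
    using Q H by (auto simp: procrustes_minimizer_def orthogonal_matrix_mul)
  then have "(norm (V - W ** Q))\<^sup>2 \<le> (norm (V - W ** (Q ** H)))\<^sup>2"
    using Q unfolding procrustes_minimizer_def by (intro power_mono) auto
  then have "V \<bullet> ((W ** Q) ** H) \<le> V \<bullet> ((W ** Q) ** mat 1)"
    using norm[OF oQ(1)] norm[OF oQ(2)] by (simp add: matrix_mul_assoc)
  then show ?thesis
    unfolding inner_matrix_mult N_def .
qed

definition reflection :: "real^'n::finite \<Rightarrow> real^'n^'n" where
  "reflection x = mat 1 - 2 *\<^sub>R outer x x"

lemma reflection_mult: "reflection x *v z = z - (2 * (x \<bullet> z)) *\<^sub>R x"
  by (simp add: reflection_def matrix_vector_mult_diff_rdistrib outer_mult scaleR_matrix_vector_assoc[symmetric])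

lemma orthogonal_reflection:
  assumes "norm x = 1"
  shows "orthogonal_matrix (reflection x)"
proof -
  have "transpose (reflection x) = reflection x"
    by (simp add: vec_eq_iff transpose_def reflection_def outer_def mat_def mult.commute)
  moreover have "reflection x *v (reflection x *v z) = z" for z
  proof -
    have "x \<bullet> (reflection x *v z) = - (x \<bullet> z)"
      using assms by (simp add: reflection_mult inner_diff_right norm_eq_1)
    then show ?thesis
      by (simp add: reflection_mult[of x "_ *v _"]) (simp add: reflection_mult)
  qed
  then have "reflection x ** reflection x = mat 1"
    by (simp add: matrix_eq flip: matrix_vector_mul_assoc)
  ultimately show ?thesis
    by (simp add: orthogonal_matrix)
qed

lemma reflection_mult_reflection:
  "reflection x ** reflection y
     = mat 1 - 2 *\<^sub>R outer x x - 2 *\<^sub>R outer y y + (4 * (x \<bullet> y)) *\<^sub>R outer x y"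
proof -
  have "reflection x *v (reflection y *v z)
     = (mat 1 - 2 *\<^sub>R outer x x - 2 *\<^sub>R outer y y + (4 * (x \<bullet> y)) *\<^sub>R outer x y) *v z" for z
    by (simp add: reflection_mult matrix_vector_mult_diff_rdistrib matrix_vector_mult_add_rdistrib outer_mult
        scaleR_matrix_vector_assoc[symmetric] inner_diff_right algebra_simps)
  then show ?thesis
    by (simp add: matrix_eq flip: matrix_vector_mul_assoc)
qed

text \<open>Such an $N$ is symmetric and positive semidefinite, as in a polar decomposition. Both properties
  follow by testing special orthogonal matrices: a single reflection gives $\langle x, N x\rangle \ge 0$.\<close>

lemma identity_maximal_imp_positive_semidefinite:
  fixes N :: "real^'k::finite^'k"
  assumes "\<And>H. orthogonal_matrix H \<Longrightarrow> N \<bullet> H \<le> N \<bullet> mat 1"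
  shows "0 \<le> x \<bullet> (N *v x)"
proof -
  have unit: "0 \<le> x \<bullet> (N *v x)" if "norm x = 1" for x
    using assms[OF orthogonal_reflection[OF that]]
    by (simp add: reflection_def inner_diff_right inner_matrix_outer)
  have x: "norm x *\<^sub>R sgn x = x"
    by (cases "x = 0") (simp_all add: sgn_div_norm)
  have "0 \<le> (norm x)\<^sup>2 * (sgn x \<bullet> (N *v sgn x))"
    using unit[of "sgn x"] by (cases "x = 0") (auto simp: norm_sgn)
  also have "\<dots> = (norm x *\<^sub>R sgn x) \<bullet> (N *v (norm x *\<^sub>R sgn x))"
    by (simp only: matrix_vector_mult_scaleR inner_scaleR_left inner_scaleR_right power2_eq_square mult.assoc)
  finally show ?thesis
    unfolding x .
qed

text \<open>Symmetry comes from rotations close to the identity, written as products of two reflections in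
  nearby hyperplanes with normals $x$ and $x + t z$, $z \perp x$. The first-order term in $t$ is the
  antisymmetric part of $N$, and it has to vanish.\<close>

lemma identity_maximal_imp_symmetric:
  fixes N :: "real^'k::finite^'k"
  assumes max: "\<And>H. orthogonal_matrix H \<Longrightarrow> N \<bullet> H \<le> N \<bullet> mat 1"
  shows "transpose N = N"
proof -
  have two: "2 * (x \<bullet> y) * (x \<bullet> (N *v y)) \<le> (x \<bullet> (N *v x)) * (y \<bullet> y) + y \<bullet> (N *v y)"
    if x: "norm x = 1" and u: "norm u = 1" and y: "y = n *\<^sub>R u" for x y u n
  proof -
    have "N \<bullet> (reflection x ** reflection u) \<le> N \<bullet> mat 1"
      using x u by (intro max orthogonal_matrix_mul orthogonal_reflection)
    then have "2 * (x \<bullet> u) * (x \<bullet> (N *v u)) \<le> x \<bullet> (N *v x) + u \<bullet> (N *v u)"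
      by (simp add: reflection_mult_reflection inner_diff_right inner_add_right inner_matrix_outer)
    then have "n\<^sup>2 * (2 * (x \<bullet> u) * (x \<bullet> (N *v u))) \<le> n\<^sup>2 * (x \<bullet> (N *v x) + u \<bullet> (N *v u))"
      by (intro mult_left_mono) auto
    moreover have "u \<bullet> u = 1"
      using u by (simp add: norm_eq_1)
    ultimately show ?thesis
      by (simp add: y matrix_vector_mult_scaleR power2_eq_square algebra_simps)
  qed
  have le: "x \<bullet> (N *v z) \<le> z \<bullet> (N *v x) + \<epsilon>"
    if xz: "norm x = 1" "norm z = 1" "x \<bullet> z = 0" and \<epsilon>: "\<epsilon> > 0" for x z \<epsilon>
  proof -
    define c where "c = x \<bullet> (N *v x) + z \<bullet> (N *v z)"
    have c: "0 \<le> c"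
      unfolding c_def using max by (intro add_nonneg_nonneg identity_maximal_imp_positive_semidefinite)
    define t where "t = \<epsilon> / (c + 1)"
    have t: "0 < t" "t * c \<le> \<epsilon>"
      using c \<epsilon> by (auto simp: t_def field_simps)
    have eqs: "x \<bullet> x = 1" "z \<bullet> z = 1" "z \<bullet> x = 0"
      using xz by (simp_all add: norm_eq_1 inner_commute)
    have xy: "x \<bullet> (x + t *\<^sub>R z) = 1" "(x + t *\<^sub>R z) \<bullet> (x + t *\<^sub>R z) = 1 + t\<^sup>2"
      using xz eqs by (simp_all add: inner_add_left inner_add_right power2_eq_square)
    then have "x + t *\<^sub>R z \<noteq> 0"
      using zero_less_power2[of t] t by auto
    then have "norm (sgn (x + t *\<^sub>R z)) = 1" "x + t *\<^sub>R z = norm (x + t *\<^sub>R z) *\<^sub>R sgn (x + t *\<^sub>R z)"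
      by (simp_all add: norm_sgn sgn_div_norm)
    from two[OF xz(1) this] have
      "2 * (x \<bullet> (N *v x) + t * (x \<bullet> (N *v z))) \<le> x \<bullet> (N *v x) * (1 + t\<^sup>2)
        + (x \<bullet> (N *v x) + t * (x \<bullet> (N *v z)) + t * (z \<bullet> (N *v x)) + t\<^sup>2 * (z \<bullet> (N *v z)))"
      unfolding xy by (simp add: matrix_vector_right_distrib matrix_vector_mult_scaleR inner_add_left
          inner_add_right power2_eq_square algebra_simps)
    then have "t * (x \<bullet> (N *v z)) \<le> t * (z \<bullet> (N *v x) + t * c)"
      by (simp add: c_def power2_eq_square algebra_simps)
    then show ?thesis
      using t by simp
  qed
  have axes: "axis i 1 \<bullet> (N *v axis j 1) = N $ i $ j" for i j
    by (simp add: inner_axis' matrix_vector_mul_component inner_axis)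
  have "N $ i $ j \<le> N $ j $ i" for i j
  proof (cases "i = j")
    case False
    have "axis i 1 \<bullet> (axis j 1 :: real^'k) = 0"
      using False by (simp add: inner_axis_axis)
    from le[OF norm_axis_1 norm_axis_1 this] show ?thesis
      unfolding axes by (rule field_le_epsilon)
  qed simp
  then show ?thesis
    by (simp add: vec_eq_iff transpose_def order_antisym)
qed

text \<open>Let $D = (I - W W^\top) V$. As $N^2 = N^\top N = V^\top W W^\top V = I - V^\top D$ and
  $N \ge 0$, the vector $y = N x - x$ satisfies $(N + I) y = - V^\top D x$, hence $\|y\| \le \|D x\|$. The
  claim follows from $(V - W Q) x = D x + W Q y$.\<close>

lemma procrustes_bound:
  fixes V W :: "real^'k::finite^'n::finite"
  assumes Q: "procrustes_minimizer V W Q"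
    and V: "transpose V ** V = mat 1" and W: "transpose W ** W = mat 1"
  shows "norm ((V - W ** Q) *v x) \<le> 2 * norm (V *v x - W *v (transpose W *v (V *v x)))"
proof -
  define N where "N = transpose (W ** Q) ** V"
  have max: "N \<bullet> H \<le> N \<bullet> mat 1" if "orthogonal_matrix H" for H
    using procrustes_minimizer_optimal[OF Q W that] by (simp add: N_def)
  have QQ: "Q *v (transpose Q *v z) = z" "transpose Q *v (Q *v z) = z" for z
    using Q by (simp_all add: procrustes_minimizer_def orthogonal_matrix_def matrix_vector_mul_assoc)
  have N: "N *v z = transpose Q *v (transpose W *v (V *v z))" for z
    by (simp add: N_def matrix_transpose_mul matrix_vector_mul_assoc matrix_mul_assoc)
  have Nt: "transpose N *v z = transpose V *v (W *v (Q *v z))" for z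
    by (simp add: N_def matrix_transpose_mul matrix_vector_mul_assoc matrix_mul_assoc)
  define d where "d = V *v x - W *v (transpose W *v (V *v x))"
  define y where "y = N *v x - x"
  have "N *v y + y = transpose N *v (N *v x) - x"
    by (simp add: y_def identity_maximal_imp_symmetric[OF max] matrix_vector_mult_diff_distrib)
  also have "\<dots> = - (transpose V *v d)"
    by (simp add: Nt N QQ d_def matrix_vector_mult_diff_distrib matrix_vector_mul_assoc[of "transpose V" V] V)
  finally have Ny: "N *v y + y = - (transpose V *v d)" .
  have "norm y * norm y \<le> y \<bullet> (N *v y + y)"
    using identity_maximal_imp_positive_semidefinite[OF max, of y]
    by (simp add: inner_add_right flip: power2_norm_eq_inner power2_eq_square)
  also have "\<dots> \<le> norm y * norm (N *v y + y)"
    by (rule norm_cauchy_schwarz)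
  also have "\<dots> \<le> norm y * norm d"
    unfolding Ny norm_minus_cancel
    by (intro mult_left_mono norm_transpose_mult_orthonormal_columns V norm_ge_zero)
  finally have y: "norm y \<le> norm d"
    by (cases "y = 0") auto
  have "(V - W ** Q) *v x = d + W *v (Q *v y)"
    by (simp add: d_def y_def N QQ matrix_vector_mult_diff_distrib matrix_vector_mult_diff_rdistrib
        flip: matrix_vector_mul_assoc)
  also have "norm \<dots> \<le> norm d + norm (W *v (Q *v y))"
    by (rule norm_triangle_ineq)
  also have "norm (W *v (Q *v y)) = norm y"
    using Q by (simp add: norm_mult_orthonormal_columns W procrustes_minimizer_def orthogonal_matrix_def)
  finally show ?thesis
    using y by (simp add: d_def)
qed

section \<open>Perturbation of the leading singular vectors\<close>

text \<open>The range of \<open>A\<close> is the test space for the lower bound on the singular values of \<open>T r\<close>: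
  \<open>transpose A\<close> is bounded below there, and for small \<open>r\<close> so is \<open>transpose (T r)\<close>, with half the constant.
  A singular vector of \<open>T r\<close> is therefore $T^r x$ with bounded $x$, and its component outside the range
  of \<open>A\<close> is at most $\|(T^r - A) x\|$.\<close>

lemma singular_vectors_perturbation:
  fixes A :: "real^'s::finite^'n::finite" and W :: "real^'k::{finite,linorder}^'n"
    and T :: "real \<Rightarrow> real^'s^'n"
  assumes W: "first_left_singular_vectors A W" and rank: "rank A = CARD('k)"
    and T: "\<forall>\<^sub>F r in at_right 0. \<forall>i. norm (column i (T r - A)) \<le> b * r"
    and V: "\<forall>\<^sub>F r in at_right 0. first_left_singular_vectors (T r) (V r)"
    and Q: "\<forall>\<^sub>F r in at_right 0. procrustes_minimizer (V r) W (Q r)"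
  obtains K where "0 \<le> K"
    "\<forall>\<^sub>F r in at_right 0. \<forall>x. norm ((V r - W ** Q r) *v x) \<le> K * r * norm x"
    "\<forall>\<^sub>F r in at_right 0. \<forall>k. column k (V r) \<in> range ((*v) (T r))"
proof -
  obtain c where c: "0 < c" "\<And>y. y \<in> range ((*v) A) \<Longrightarrow> c * norm y \<le> norm (transpose A *v y)"
    using transpose_bounded_below_on_range by blast
  have oW: "transpose W ** W = mat 1"
    by (rule first_left_singular_vectors_orthonormal[OF W])
  have PA: "W *v (transpose W *v (A *v x)) = A *v x" for x
    by (rule orthonormal_columns_projection[OF oW]) (simp add: first_left_singular_vectors_range[OF W rank])
  define s where "s = real CARD('s)"
  define K where "K = 2 * (real CARD('k) * (s * \<bar>b\<bar> * (2 / c)))"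
  have "\<forall>\<^sub>F r in at_right 0. s * \<bar>b\<bar> * r < c / 2"
  proof -
    have "((\<lambda>r. s * \<bar>b\<bar> * r) \<longlongrightarrow> s * \<bar>b\<bar> * 0) (at_right 0)"
      by (intro tendsto_intros)
    then show ?thesis
      using c(1) by (intro order_tendstoD(2)) auto
  qed
  moreover have "\<forall>\<^sub>F r in at_right (0::real). 0 < r"
    by (simp add: eventually_at_right_less)
  ultimately have ev: "\<forall>\<^sub>F r in at_right 0.
      (\<forall>x. norm ((V r - W ** Q r) *v x) \<le> K * r * norm x) \<and> (\<forall>k. column k (V r) \<in> range ((*v) (T r)))"
    using T V Q
  proof eventually_elim
    case (elim r)
    have TA: "norm ((T r - A) *v x) \<le> s * \<bar>b\<bar> * r * norm x" for x
    proof -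
      have "norm (column i (T r - A)) \<le> \<bar>b\<bar> * r" for i
        using elim(2,3) mult_right_mono[of b "\<bar>b\<bar>" r] by (metis abs_ge_self less_imp_le order_trans)
      from norm_matrix_mult_le_of_columns[OF this] show ?thesis
        by (simp add: s_def mult.assoc)
    qed
    have below: "c / 2 * norm y \<le> norm (transpose (T r) *v y)" if "y \<in> range ((*v) A)" for y
    proof -
      have "transpose (T r) *v y = transpose A *v y + transpose (T r - A) *v y"
        by (simp add: transpose_def vec_eq_iff matrix_vector_mult_def algebra_simps flip: sum.distrib)
      then have "norm (transpose A *v y) - norm (transpose (T r - A) *v y) \<le> norm (transpose (T r) *v y)"
        by (simp add: norm_diff_ineq)
      moreover have "norm (transpose (T r - A) *v y) \<le> s * \<bar>b\<bar> * r * norm y"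
        by (rule norm_transpose_mult_le[OF TA])
      moreover have "s * \<bar>b\<bar> * r * norm y \<le> c / 2 * norm y"
        using elim(1) by (intro mult_right_mono) auto
      ultimately show ?thesis
        using c(2)[OF that] by (simp add: field_simps)
    qed
    have sub: "subspace (range ((*v) A))" and dimA: "CARD('k) \<le> dim (range ((*v) A))"
      and le: "CARD('k) \<le> CARD('s)"
      using rank rank_le_columns[of A] by (auto simp: linear_subspace_image rank_dim_range)
    have pre: "\<exists>x. norm x \<le> 2 / c \<and> column k (V r) = T r *v x" for k
    proof -
      obtain x where "norm x \<le> 1 / (c / 2)" "column k (V r) = T r *v x"
        by (rule first_left_singular_vectors_preimage[OF elim(4) le sub dimA, of "c / 2" k]) (use c(1) below in auto)
      then show ?thesis
        by auto
    qed
    let ?D = "V r - W ** (transpose W ** V r)"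
    have D: "?D *v x = V r *v x - W *v (transpose W *v (V r *v x))" for x
      by (simp add: matrix_vector_mult_diff_rdistrib flip: matrix_vector_mul_assoc)
    have "norm (column k ?D) \<le> s * \<bar>b\<bar> * r * (2 / c)" for k
    proof -
      obtain x where x: "norm x \<le> 2 / c" "column k (V r) = T r *v x"
        using pre by blast
      have "column k ?D = ?D *v axis k 1"
        by (simp add: matrix_vector_mul_component matrix_vector_mult_basis)
      also have "\<dots> = T r *v x - W *v (transpose W *v (T r *v x))"
        unfolding D by (simp add: matrix_vector_mult_basis x(2))
      also have "\<dots> = (T r - A) *v x - W *v (transpose W *v ((T r - A) *v x))"
        by (simp add: matrix_vector_mult_diff_rdistrib matrix_vector_mult_diff_distrib PA)
      finally have "norm (column k ?D) \<le> norm ((T r - A) *v x)"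
        by (simp add: norm_orthogonal_complement_le[OF oW])
      also have "\<dots> \<le> s * \<bar>b\<bar> * r * norm x"
        by (rule TA)
      also have "\<dots> \<le> s * \<bar>b\<bar> * r * (2 / c)"
        using x(1) elim(2) by (intro mult_left_mono) (auto simp: s_def)
      finally show ?thesis .
    qed
    from norm_matrix_mult_le_of_columns[OF this] have
      "norm (V r *v x - W *v (transpose W *v (V r *v x))) \<le> K / 2 * r * norm x" for x
      unfolding D by (simp add: K_def mult_ac)
    moreover have "norm ((V r - W ** Q r) *v x) \<le> 2 * norm (V r *v x - W *v (transpose W *v (V r *v x)))" for x
      by (rule procrustes_bound[OF elim(5) first_left_singular_vectors_orthonormal[OF elim(4)] oW])
    ultimately have "norm ((V r - W ** Q r) *v x) \<le> 2 * (K / 2 * r * norm x)" for x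
      by (meson mult_left_mono order_trans zero_le_numeral)
    then have "\<forall>x. norm ((V r - W ** Q r) *v x) \<le> K * r * norm x"
      by simp
    moreover have "column k (V r) \<in> range ((*v) (T r))" for k
      using pre[of k] by (metis rangeI)
    ultimately show ?case
      by simp
  qed
  have "0 \<le> K"
    using c(1) by (simp add: K_def s_def)
  then show thesis
    using ev that by (simp add: eventually_conj_iff)
qed

section \<open>Quadratic forms and the upper triangle\<close>

lemma sum_upper:
  fixes F :: "'q::{finite,linorder} \<Rightarrow> 'q \<Rightarrow> 'b::real_vector"
  assumes sym: "\<And>j l. F j l = F l j"
  shows "(\<Sum>p\<in>UNIV. (2 - kronecker (row_of p) (col_of p)) *\<^sub>R F (row_of p) (col_of p))
    = (\<Sum>j\<in>UNIV. \<Sum>l\<in>UNIV. F j l)"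
proof -
  let ?G = "\<lambda>(j, l). F j l" and ?U = "{(j :: 'q, l). j \<le> l}" and ?L = "{(j :: 'q, l). l < j}"
  have bij: "bij_betw pair_of (UNIV :: 'q upper set) ?U"
  proof (rule bij_betwI')
    show "pair_of p = pair_of p' \<longleftrightarrow> p = p'" for p p' :: "'q upper"
      by (rule pair_of_inject)
    show "pair_of p \<in> ?U" for p :: "'q upper"
      by (rule pair_of)
    show "\<exists>p\<in>UNIV. x = pair_of p" if "x \<in> ?U" for x
      using Upper_inverse[OF that] by (metis UNIV_I)
  qed
  have "(\<Sum>p\<in>UNIV. (2 - kronecker (row_of p) (col_of p)) *\<^sub>R F (row_of p) (col_of p))
      = (\<Sum>(j, l)\<in>?U. (2 - kronecker j l) *\<^sub>R F j l)"
    using sum.reindex_bij_betw[OF bij, of "\<lambda>(j, l). (2 - kronecker j l) *\<^sub>R F j l"]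
    by (simp add: row_of_def col_of_def case_prod_beta)
  also have "\<dots> = sum ?G ?U + (\<Sum>(j, l)\<in>?U. if j \<noteq> l then F j l else 0)"
    unfolding sum.distrib[symmetric] by (rule sum.cong) (auto simp: kronecker_def scaleR_2)
  also have "(\<Sum>(j, l)\<in>?U. if j \<noteq> l then F j l else 0) = sum ?G {(j, l). j < l}"
    by (rule sum.mono_neutral_cong_right) (auto split: if_splits)
  also have "\<dots> = sum ?G ?L"
    by (rule sum.reindex_bij_witness[of _ prod.swap prod.swap]) (auto simp: sym)
  also have "sum ?G ?U + sum ?G ?L = sum ?G (?U \<union> ?L)"
    by (rule sum.union_disjoint[symmetric]) auto
  also have "?U \<union> ?L = UNIV \<times> UNIV"
    by auto
  finally show ?thesis
    by (simp add: sum.cartesian_product)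
qed

text \<open>The factor $2 - \delta_{jl}$ counts each off-diagonal pair twice.\<close>

lemma Q_base_mult_vecsym:
  fixes U :: "real^('q::{finite,linorder}) \<Rightarrow> real^'n::finite"
  assumes X: "open X" "0 \<in> X" and U: "Ck_on 2 U X"
  shows "Q_base U *v vecsym (outer x x)
    = (\<Sum>j\<in>UNIV. \<Sum>l\<in>UNIV. (x $ j * x $ l) *\<^sub>R partial l (partial j U) 0)"
proof -
  have "Q_base U *v vecsym (outer x x) = (\<Sum>p\<in>UNIV. (2 - kronecker (row_of p) (col_of p)) *\<^sub>R
      ((x $ row_of p * x $ col_of p) *\<^sub>R partial (row_of p) (partial (col_of p) U) 0))"
    by (simp add: vec_eq_iff matrix_vector_mult_def Q_base_def matrix_of_columns_def vecsym_def outer_def mult_ac)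
  also have "\<dots> = (\<Sum>j\<in>UNIV. \<Sum>l\<in>UNIV. (x $ j * x $ l) *\<^sub>R partial j (partial l U) 0)"
    by (rule sum_upper) (simp add: partial_commute[OF X U] mult.commute)
  finally show ?thesis
    by (simp add: partial_commute[OF X U])
qed

lemma expansion_at_0:
  fixes U :: "real^('q::{finite,linorder}) \<Rightarrow> real^'n::finite"
  assumes X: "open X" "cball 0 1 \<subseteq> X" and U: "Ck_on 3 U X"
  obtains b where "0 \<le> b" "\<And>x. x \<in> cball 0 1 \<Longrightarrow>
    norm (U x - U 0 - jacobian U (at 0) *v x - (1/2) *\<^sub>R (Q_base U *v vecsym (outer x x))) \<le> b * norm x ^ 3"
proof -
  have 0: "0 \<in> X"
    using X(2) by auto
  have "Ck_on 2 U X" "U differentiable (at 0)"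
    using U 0 by (auto simp: numeral_2_eq_2 numeral_3_eq_3 differentiable_imp_continuous_within
        intro!: continuous_at_imp_continuous_on)
  then have eqs: "jacobian U (at 0) *v x = (\<Sum>j\<in>UNIV. x $ j *\<^sub>R partial j U 0)"
    "Q_base U *v vecsym (outer x x) = (\<Sum>j\<in>UNIV. \<Sum>l\<in>UNIV. (x $ j * x $ l) *\<^sub>R partial l (partial j U) 0)" for x
    by (simp_all add: jacobian_mult_eq_partial Q_base_mult_vecsym[OF X(1) 0])
  show thesis
    by (rule second_order_Taylor[OF X(2) U, folded eqs]) (rule that)
qed

lemma norm_vecsym_outer_le: "norm (vecsym (outer x y)) \<le> real CARD('q upper) * (norm x * norm y)"
  for x y :: "real^('q::{finite,linorder})"
proof -
  have "norm (vecsym (outer x y)) \<le> (\<Sum>p\<in>UNIV. \<bar>vecsym (outer x y) $ p\<bar>)"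
    by (rule norm_le_l1_cart)
  also have "\<dots> \<le> (\<Sum>p\<in>(UNIV :: 'q upper set). norm x * norm y)"
    by (intro sum_mono) (simp add: vecsym_def outer_def abs_mult mult_mono component_le_norm_cart)
  finally show ?thesis
    by simp
qed

lemma norm_vecsym_outer_diff_le:
  fixes x y :: "real^('q::{finite,linorder})"
  shows "norm (vecsym (outer x x) - vecsym (outer y y))
    \<le> real CARD('q upper) * (norm (x - y) * (norm x + norm y))"
proof -
  have "vecsym (outer x x) - vecsym (outer y y) = vecsym (outer (x - y) x) + vecsym (outer y (x - y))"
    by (simp add: vec_eq_iff vecsym_def outer_def algebra_simps)
  also have "norm \<dots> \<le> real CARD('q upper) * (norm (x - y) * norm x) + real CARD('q upper) * (norm y * norm (x - y))"
    by (intro order_trans[OF norm_triangle_ineq] add_mono norm_vecsym_outer_le)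
  finally show ?thesis
    by (simp add: algebra_simps)
qed

lemma homogeneous_quadratic_vecsym:
  fixes R :: "real^('q::{finite,linorder} upper)^'m::finite" and B :: "real^'k::finite^('q::{finite,linorder})"
  shows "homogeneous_quadratic (\<lambda>a. R *v vecsym (outer (B *v a) (B *v a)))"
  unfolding homogeneous_quadratic_def
proof
  fix k
  define G where "G = (\<Sum>p\<in>UNIV. (R $ k $ p) *\<^sub>R outer (B $ row_of p) (B $ col_of p))"
  have G: "(R *v vecsym (outer (B *v a) (B *v a))) $ k = a \<bullet> (G *v a)" for a
  proof -
    have "a \<bullet> (G *v a) = (\<Sum>p\<in>UNIV. R $ k $ p * ((B $ row_of p \<bullet> a) * (B $ col_of p \<bullet> a)))"
      unfolding G_def matrix_vector_mult_sum inner_sum_right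
      by (simp add: outer_mult inner_commute mult_ac scaleR_matrix_vector_assoc[symmetric])
    then show ?thesis
      by (simp add: matrix_vector_mul_component[of R] vecsym_def outer_def matrix_vector_mul_component
          inner_vec_def[of "R $ k"])
  qed
  show "\<exists>G. transpose G = G \<and> (\<forall>x. (R *v vecsym (outer (B *v x) (B *v x))) $ k = x \<bullet> (G *v x))"
  proof (intro exI conjI allI)
    show "transpose ((1/2) *\<^sub>R (G + transpose G)) = (1/2) *\<^sub>R (G + transpose G)"
      by (simp add: transpose_def vec_eq_iff)
    show "(R *v vecsym (outer (B *v x) (B *v x))) $ k = x \<bullet> (((1/2) *\<^sub>R (G + transpose G)) *v x)" for x
      using inner_matrix_vector_mult[of G x x]
      by (simp add: G matrix_vector_mult_add_rdistrib inner_add_right inner_commute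
          scaleR_matrix_vector_assoc[symmetric])
  qed
qed

section \<open>The normal space and the curvature matrix\<close>

lemma normal_component_eq:
  fixes W :: "real^'k::finite^'n::finite"
  assumes W: "transpose W ** W = mat 1" and T: "range ((*v) W) = T"
  shows "normal_component T x = x - W *v (transpose W *v x)"
  unfolding normal_component_def
proof (rule the_equality)
  let ?y = "x - W *v (transpose W *v x)"
  have orth: "?y \<bullet> (W *v z) = 0" for z
  proof -
    have "transpose W *v ?y = 0"
      by (simp add: matrix_vector_mult_diff_distrib matrix_vector_mul_assoc matrix_mul_assoc W)
    then show ?thesis
      using inner_matrix_vector_mult[of W z ?y] by (simp add: inner_commute)
  qed
  then show "x - ?y \<in> T \<and> (\<forall>t\<in>T. orthogonal ?y t)"
    using T by (auto simp: orthogonal_def)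
  fix y assume y: "x - y \<in> T \<and> (\<forall>t\<in>T. orthogonal y t)"
  have "subspace T"
    unfolding T[symmetric] by (simp add: linear_subspace_image)
  moreover have "x - ?y \<in> T"
    using T by auto
  ultimately have d: "(x - ?y) - (x - y) \<in> T"
    by (rule subspace_diff[OF _ _ conjunct1[OF y]])
  then obtain z where z: "(x - ?y) - (x - y) = W *v z"
    using T by blast
  have "y - ?y = (x - ?y) - (x - y)"
    by simp
  then have "(y - ?y) \<bullet> (y - ?y) = y \<bullet> ((x - ?y) - (x - y)) - ?y \<bullet> (W *v z)"
    unfolding z[symmetric] by (simp only: inner_diff_left)
  also have "\<dots> = 0"
    using y d orth by (simp add: orthogonal_def)
  finally show "y = ?y"
    by simp
qed

lemma range_mult_full_rank:
  fixes A :: "real^'m::finite^'n::finite" and B :: "real^'s::finite^'m"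
  assumes "rank B = CARD('m)"
  shows "range ((*v) (A ** B)) = range ((*v) A)"
proof -
  have "surj ((*v) B)"
    using assms by (simp add: full_rank_surjective)
  then have "range ((*v) A \<circ> (*v) B) = range ((*v) A)"
    by (simp only: image_comp[symmetric])
  then show ?thesis
    by (simp add: comp_def matrix_vector_mul_assoc)
qed

text \<open>Up to the nonzero factors $2 - \delta_{jl}$, the columns are the normal components of the second
  derivatives, which span a space of dimension $q(q+1)/2$.\<close>

lemma rank_projected_Q_base:
  fixes U :: "real^('q::{finite,linorder}) \<Rightarrow> real^'n::finite"
  assumes W: "transpose W ** W = mat 1" and range: "range ((*v) W) = tangent_space U 0"
    and rank: "dim (span {normal_component (tangent_space U 0) (partial j (partial l U) 0) | j l. j \<le> l})
      = CARD('q upper)"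
  shows "rank ((mat 1 - W ** transpose W) ** Q_base U) = CARD('q upper)"
proof -
  let ?A = "(mat 1 - W ** transpose W) ** Q_base U"
  let ?N = "\<lambda>x. x - W *v (transpose W *v x)"
  have N: "normal_component (tangent_space U 0) x = ?N x" for x
    by (rule normal_component_eq[OF W range])
  have "{normal_component (tangent_space U 0) (partial j (partial l U) 0) | j l. j \<le> l} \<subseteq> span (columns ?A)"
  proof clarify
    fix j l :: 'q assume "j \<le> l"
    then have p: "row_of (Upper (j, l)) = j" "col_of (Upper (j, l)) = l"
      by (simp_all add: row_of_def col_of_def Upper_inverse)
    have "column (Upper (j, l)) (Q_base U) = (2 - kronecker j l) *\<^sub>R partial j (partial l U) 0"
      by (simp add: column_def Q_base_def matrix_of_columns_def p vec_eq_iff)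
    then have "column (Upper (j, l)) ?A = (2 - kronecker j l) *\<^sub>R ?N (partial j (partial l U) 0)"
      by (simp add: matrix_vector_mult_scaleR scaleR_diff_right matrix_vector_mult_diff_rdistrib
          flip: matrix_vector_mult_basis matrix_vector_mul_assoc)
    then have "?N (partial j (partial l U) 0) = (1 / (2 - kronecker j l)) *\<^sub>R column (Upper (j, l)) ?A"
      by (simp add: kronecker_def)
    moreover have "column (Upper (j, l)) ?A \<in> columns ?A"
      by (auto simp: columns_def)
    ultimately show "normal_component (tangent_space U 0) (partial j (partial l U) 0) \<in> span (columns ?A)"
      unfolding N by (metis span_base span_scale)
  qed
  from dim_subset[OF this] have "CARD('q upper) \<le> rank ?A"
    using rank by (simp add: column_rank_def)
  then show ?thesis
    using rank_le_columns[of ?A] by simp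
qed

lemma R_matrix_eq:
  "R_matrix U Pi0 U2s = (1/2) *\<^sub>R (transpose U2s ** ((mat 1 - Pi0) ** Q_base U))"
  for U :: "real^('q::{finite,linorder}) \<Rightarrow> real^'n::finite"
proof -
  have "(transpose U2s ** ((mat 1 - Pi0) ** Q_base U)) $ k $ p = (2 - kronecker (row_of p) (col_of p)) *
     (column k U2s \<bullet> ((mat 1 - Pi0) *v partial (row_of p) (partial (col_of p) U) 0))" for k p
  proof -
    have "(transpose U2s ** ((mat 1 - Pi0) ** Q_base U)) $ k $ p
        = column k U2s \<bullet> column p ((mat 1 - Pi0) ** Q_base U)"
      by (simp add: matrix_matrix_mult_def column_def inner_vec_def transpose_def)
    also have "column p ((mat 1 - Pi0) ** Q_base U) = (mat 1 - Pi0) *v column p (Q_base U)"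
      by (simp add: matrix_vector_mul_assoc flip: matrix_vector_mult_basis)
    also have "column p (Q_base U) = (2 - kronecker (row_of p) (col_of p)) *\<^sub>R partial (row_of p) (partial (col_of p) U) 0"
      by (simp add: column_def Q_base_def matrix_of_columns_def vec_eq_iff)
    finally show ?thesis
      by (simp add: matrix_vector_mult_scaleR)
  qed
  then show ?thesis
    by (simp add: R_matrix_def vec_eq_iff)
qed

section \<open>The curvature coefficients\<close>

lemma transpose_mult_split:
  "transpose V *v y = transpose Q *v (transpose W *v y) + transpose (V - W ** Q) *v y"
  for V :: "real^'k::finite^'n::finite" and W :: "real^'j::finite^'n" and Q :: "real^'k^'j"
proof -
  have "transpose (V - W ** Q) = transpose V - transpose Q ** transpose W"
    by (simp add: matrix_transpose_mul[symmetric]) (simp add: transpose_def vec_eq_iff)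
  then show ?thesis
    by (simp add: matrix_vector_mult_diff_rdistrib matrix_vector_mul_assoc)
qed

lemma matrix_mult_bounded:
  fixes A :: "real^'n::finite^'m::finite"
  obtains K where "0 \<le> K" "\<And>x. norm (A *v x) \<le> K * norm x"
  using bounded_linear.nonneg_bounded[OF matrix_vector_mul_bounded_linear[of A]] by (metis mult.commute)

theorem mainTheorem5:
  fixes S :: "(real^'n) set"
    and Q0 :: "(real^('q::{finite,linorder})) set"
    and U :: "real^('q::{finite,linorder}) \<Rightarrow> real^'n"
    and chart :: "real^'n \<Rightarrow> real^('q::{finite,linorder})"
    and ustar :: "real^'n"
    and nu :: "'s::finite \<Rightarrow> real^('q::{finite,linorder})"
    and Pi0 :: "real^'n^'n"
    and J0 :: "real^('q::{finite,linorder})^'n"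
    and P :: "real^'s^('q::{finite,linorder})"
    and U1 :: "real \<Rightarrow> real^('q::{finite,linorder})^'n" and U1s :: "real^('q::{finite,linorder})^'n"
    and O1 :: "real \<Rightarrow> real^('q::{finite,linorder})^('q::{finite,linorder})"
    and As :: "real^('q::{finite,linorder})^('q::{finite,linorder})"
    and U2 :: "real \<Rightarrow> real^('q::{finite,linorder} upper)^'n" and U2s :: "real^('q::{finite,linorder} upper)^'n"
    and O2 :: "real \<Rightarrow> real^('q::{finite,linorder} upper)^('q::{finite,linorder} upper)"
    and v :: "real^('q::{finite,linorder}) \<Rightarrow> real^'n"
    and \<alpha>1 :: "real \<Rightarrow> real^('q::{finite,linorder}) \<Rightarrow> real^('q::{finite,linorder})"
    and \<alpha>2 :: "real \<Rightarrow> real^('q::{finite,linorder}) \<Rightarrow> real^('q::{finite,linorder} upper)"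
    and B :: "real \<Rightarrow> real^('q::{finite,linorder})^('q::{finite,linorder})"
    and R :: "real \<Rightarrow> real^('q::{finite,linorder} upper)^('q::{finite,linorder} upper)"
  assumes S: "embedded_submanifold 1 CARD('q) S" "ustar \<in> S"
    and U: "open Q0" "cball 0 1 \<subseteq> Q0" "homeomorphism Q0 (U ` Q0) U chart"
      "openin (top_of_set S) (U ` Q0)" "U 0 = ustar"
    and C3: "Ck_on 3 U Q0"
    and rank_jacobian: "\<And>\<nu>. \<nu> \<in> Q0 \<Longrightarrow> rank (jacobian U (at \<nu>)) = CARD('q)"
    and rank_second_fundamental_form: "\<And>\<nu>. \<nu> \<in> Q0 \<Longrightarrow>
      dim (span {normal_component (tangent_space U \<nu>) (partial j (partial l U) \<nu>) | j l. j \<le> l})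
        = CARD('q) * (CARD('q) + 1) div 2"
    and v: "v = (\<lambda>\<nu>. U \<nu> - ustar)"
    and J0: "J0 = jacobian U (at 0)"
    and nu: "\<And>i. nu i \<in> cball 0 1"
    and P: "P = matrix_of_columns nu" "rank P = CARD('q)"
    and P2: "rank (P2_matrix nu) = CARD('q) * (CARD('q) + 1) div 2"
    and U1: "\<forall>\<^sub>F r in at_right 0. first_left_singular_vectors (snapshot_matrix U ustar nu r) (U1 r)"
    and U1s: "first_left_singular_vectors (J0 ** P) U1s"
    and Pi0: "Pi0 = U1s ** transpose U1s"
    and As: "As = transpose U1s ** J0"
    and O1: "\<forall>\<^sub>F r in at_right 0. procrustes_minimizer (U1 r) U1s (O1 r)"
    and U2: "\<forall>\<^sub>F r in at_right 0.
      first_left_singular_vectors ((mat 1 - Pi0) ** snapshot_matrix U ustar nu r) (U2 r)"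
    and U2s: "first_left_singular_vectors ((mat 1 - Pi0) ** (Q_base U ** P2_matrix nu)) U2s"
    and O2: "\<forall>\<^sub>F r in at_right 0. procrustes_minimizer (U2 r) U2s (O2 r)"
    and \<alpha>1: "\<alpha>1 = (\<lambda>r \<nu>. transpose (U1 r) *v v \<nu>)"
    and \<alpha>2: "\<alpha>2 = (\<lambda>r \<nu>. transpose (U2 r) *v v \<nu>)"
    and B: "B = (\<lambda>r. matrix_inv As ** O1 r)"
    and R: "R = (\<lambda>r. transpose (O2 r) ** R_matrix U Pi0 U2s)"
  shows "(\<exists>C. \<forall>\<^sub>F r in at_right 0. \<forall>\<nu>\<in>cball 0 r.
            norm (\<alpha>2 r \<nu> - R r *v vecsym (outer (B r *v \<alpha>1 r \<nu>) (B r *v \<alpha>1 r \<nu>)))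
              \<le> C * (r * norm (\<alpha>1 r \<nu>) ^ 2 + norm (\<alpha>1 r \<nu>) ^ 3))
       \<and> (\<forall>r. homogeneous_quadratic (\<lambda>a. R r *v vecsym (outer (B r *v a) (B r *v a))))
       \<and> (\<exists>C. \<forall>\<^sub>F r in at_right 0. \<forall>\<nu>\<in>cball 0 r.
            norm (\<alpha>2 r \<nu> - R r *v vecsym (outer (B r *v \<alpha>1 r \<nu>) (B r *v \<alpha>1 r \<nu>)))
              \<le> C * r ^ 3)"

proof -
  let ?s = "\<lambda>x. vecsym (outer x x)"
  define N0 where "N0 = mat 1 - Pi0"
  define N2 where "N2 = N0 ** Q_base U"
  define S where "S = snapshot_matrix U ustar nu"
  have 0: "0 \<in> Q0"
    using U(2) by auto
  have oW: "transpose U1s ** U1s = mat 1"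
    by (rule first_left_singular_vectors_orthonormal[OF U1s])
  have oU2s: "transpose U2s ** U2s = mat 1"
    by (rule first_left_singular_vectors_orthonormal[OF U2s])
  have N0: "N0 *v y = y - U1s *v (transpose U1s *v y)" for y
    by (simp add: N0_def Pi0 matrix_vector_mult_diff_rdistrib matrix_vector_mul_assoc)
  have N0_le: "norm (N0 *v y) \<le> norm y" for y
    unfolding N0 by (rule norm_orthogonal_complement_le[OF oW])

  \<comment> \<open>The limit of the rescaled snapshots has the tangent space as its range.\<close>
  have rankJ: "rank J0 = CARD('q)"
    using rank_jacobian[OF 0] J0 by simp
  have rangeJP: "range ((*v) (J0 ** P)) = range ((*v) J0)"
    by (rule range_mult_full_rank[OF P(2)])
  then have rankJP: "rank (J0 ** P) = CARD('q)"
    using rankJ by (simp add: rank_dim_range)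
  have rangeW: "range ((*v) U1s) = range ((*v) J0)"
    using first_left_singular_vectors_range[OF U1s rankJP] rangeJP by simp
  have N0J: "N0 *v (J0 *v x) = 0" for x
    using orthonormal_columns_projection[OF oW, of "J0 *v x"] rangeW by (simp add: N0)
  have inv: "matrix_inv As *v (As *v x) = x" for x
  proof -
    have "inj ((*v) As)"
    proof (rule injI)
      fix x y assume "As *v x = As *v y"
      then have "U1s *v (transpose U1s *v (J0 *v x)) = U1s *v (transpose U1s *v (J0 *v y))"
        by (simp add: As matrix_vector_mul_assoc)
      then have "J0 *v x = J0 *v y"
        using orthonormal_columns_projection[OF oW] rangeW by (metis rangeI)
      then show "x = y"
        using rankJ by (simp add: full_rank_injective inj_eq)
    qed
    then have "invertible As"
      by (simp add: invertible_left_inverse matrix_left_invertible_injective)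
    then have "matrix_inv As ** As = mat 1"
      unfolding invertible_def matrix_inv_def by (rule someI2_ex) simp
    then show ?thesis
      by (simp add: matrix_vector_mul_assoc)
  qed

  \<comment> \<open>Its filtered counterpart has the rank of the second fundamental form.\<close>
  have tangent: "range ((*v) U1s) = tangent_space U 0"
    by (simp add: rangeW tangent_space_def J0)
  have rankN2: "rank N2 = CARD('q upper)"
    using rank_projected_Q_base[OF oW tangent] rank_second_fundamental_form[OF 0]
    by (simp add: N2_def N0_def Pi0 card_upper)
  have "range ((*v) (N2 ** P2_matrix nu)) = range ((*v) N2)"
    by (rule range_mult_full_rank) (simp add: P2 card_upper)
  then have rank2: "rank (N2 ** P2_matrix nu) = CARD('q upper)"
    using rankN2 by (simp add: rank_dim_range)
  have U2s': "first_left_singular_vectors (N2 ** P2_matrix nu) U2s"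
    using U2s by (simp add: N2_def N0_def matrix_mul_assoc)

  \<comment> \<open>First- and second-order remainders of \<open>v\<close>; the projection removes the linear part.\<close>
  obtain b where b: "0 \<le> b" "\<And>x. x \<in> cball 0 1 \<Longrightarrow>
      norm (v x - J0 *v x - (1/2) *\<^sub>R (Q_base U *v ?s x)) \<le> b * norm x ^ 3"
    using expansion_at_0[OF U(1,2) C3] unfolding v J0 U(5)[symmetric] by blast
  obtain KQ where KQ: "0 \<le> KQ" "\<And>x. norm (Q_base U *v x) \<le> KQ * norm x"
    by (rule matrix_mult_bounded[of "Q_base U"]) blast
  define m where "m = real CARD('q upper)"
  have m: "0 \<le> m" "norm (?s x) \<le> m * (norm x)\<^sup>2" for x :: "real^('q::{finite,linorder})"
    using norm_vecsym_outer_le[of x x] by (auto simp: m_def power2_eq_square)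
  define b1 where "b1 = b + KQ * m"
  have b1: "0 \<le> b1"
    using b(1) KQ(1) m(1) by (simp add: b1_def)
  have half: "norm ((1/2) *\<^sub>R (Q_base U *v ?s x)) \<le> KQ * m * (norm x)\<^sup>2" for x
  proof -
    have "norm (Q_base U *v ?s x) \<le> KQ * (m * (norm x)\<^sup>2)"
      using KQ m(2) by (meson mult_left_mono order_trans)
    moreover have "0 \<le> KQ * (m * (norm x)\<^sup>2)"
      using KQ(1) m(1) by simp
    ultimately show ?thesis
      by (simp add: mult.assoc)
  qed
  have cube: "b * norm x ^ 3 \<le> b * (norm x)\<^sup>2" if "x \<in> cball 0 1" for x :: "real^('q::{finite,linorder})"
    using that b(1) by (intro mult_left_mono power_decreasing) auto
  have g: "norm (v x - J0 *v x) \<le> b1 * (norm x)\<^sup>2" if "x \<in> cball 0 1" for x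
  proof -
    have "norm (v x - J0 *v x) \<le> norm (v x - J0 *v x - (1/2) *\<^sub>R (Q_base U *v ?s x)) + norm ((1/2) *\<^sub>R (Q_base U *v ?s x))"
      using norm_triangle_sub by (metis add.commute)
    also have "\<dots> \<le> b * (norm x)\<^sup>2 + KQ * m * (norm x)\<^sup>2"
      by (intro add_mono half order_trans[OF b(2) cube] that)
    finally show ?thesis
      by (simp add: b1_def distrib_right)
  qed
  have g2: "norm (N0 *v v x - (1/2) *\<^sub>R (N2 *v ?s x)) \<le> b * norm x ^ 3" if "x \<in> cball 0 1" for x
  proof -
    have "N0 *v v x - (1/2) *\<^sub>R (N2 *v ?s x) = N0 *v (v x - J0 *v x - (1/2) *\<^sub>R (Q_base U *v ?s x))"
      by (simp add: matrix_vector_mult_diff_distrib matrix_vector_mult_scaleR N0J N2_def flip: matrix_vector_mul_assoc)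
    then show ?thesis
      using order_trans[OF N0_le b(2)[OF that]] by (simp only:)
  qed
  have Nv: "norm (N0 *v v x) \<le> b1 * (norm x)\<^sup>2" if "x \<in> cball 0 1" for x
  proof -
    have "N0 *v v x = N0 *v (v x - J0 *v x)"
      by (simp add: matrix_vector_mult_diff_distrib N0J)
    then show ?thesis
      using order_trans[OF N0_le g[OF that]] by (simp only:)
  qed

  have small: "\<forall>\<^sub>F r in at_right 0. 0 < r \<and> r < c" if "0 < c" for c :: real
    using that eventually_at_right_real[of 0 c] by simp
  have col_S: "column i (S r) = v (r *\<^sub>R nu i)" for i r
    by (simp add: S_def snapshot_matrix_def matrix_of_columns_def column_def v vec_eq_iff)
  have col_P: "column i P = nu i" for i
    by (simp add: P(1) matrix_of_columns_def column_def vec_eq_iff)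
  have rnu: "r *\<^sub>R nu i \<in> cball 0 1" "norm (r *\<^sub>R nu i) \<le> r" if "0 < r" "r < 1" for r i
    using nu[of i] that mult_mono[of r 1 "norm (nu i)" 1] mult_left_mono[of "norm (nu i)" 1 r] by auto

  \<comment> \<open>Singular vectors are invariant under positive scaling, so the perturbation lemma applies to the rescaled snapshots.\<close>
  have T1: "\<forall>\<^sub>F r in at_right 0. \<forall>i. norm (column i ((1 / r) *\<^sub>R S r - J0 ** P)) \<le> b1 * r"
    using small[OF zero_less_one]
  proof eventually_elim
    case (elim r)
    show ?case
    proof
      fix i
      have "column i ((1 / r) *\<^sub>R S r - J0 ** P) = (1 / r) *\<^sub>R column i (S r) - J0 *v column i P"
        by (simp add: column_matrix_mult[symmetric]) (simp add: column_def vec_eq_iff)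
      also have "\<dots> = (1 / r) *\<^sub>R (v (r *\<^sub>R nu i) - J0 *v (r *\<^sub>R nu i))"
        using elim by (simp add: col_S col_P matrix_vector_mult_scaleR scaleR_diff_right)
      also have "norm \<dots> \<le> (1 / r) * (b1 * r\<^sup>2)"
        using elim rnu[of r i] b1
        by (auto intro!: mult_left_mono order_trans[OF g] power_mono divide_right_mono)
      finally show "norm (column i ((1 / r) *\<^sub>R S r - J0 ** P)) \<le> b1 * r"
        using elim by (simp add: power2_eq_square)
    qed
  qed
  have V1: "\<forall>\<^sub>F r in at_right 0. first_left_singular_vectors ((1 / r) *\<^sub>R S r) (U1 r)"
    using U1 small[OF zero_less_one]
    by eventually_elim (auto simp: S_def intro: first_left_singular_vectors_scaleR)
  obtain K1 where K1: "0 \<le> K1" and ev1: "\<forall>\<^sub>F r in at_right 0. \<forall>x. norm ((U1 r - U1s ** O1 r) *v x) \<le> K1 * r * norm x"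
    by (rule singular_vectors_perturbation[OF U1s rankJP T1 V1 O1]) blast

  have T2: "\<forall>\<^sub>F r in at_right 0. \<forall>i. norm (column i ((2 / r\<^sup>2) *\<^sub>R (N0 ** S r) - N2 ** P2_matrix nu)) \<le> 2 * b * r"
    using small[OF zero_less_one]
  proof eventually_elim
    case (elim r)
    show ?case
    proof
      fix i
      have "column i ((2 / r\<^sup>2) *\<^sub>R (N0 ** S r) - N2 ** P2_matrix nu)
          = (2 / r\<^sup>2) *\<^sub>R (N0 *v column i (S r)) - N2 *v column i (P2_matrix nu)"
        by (simp add: column_matrix_mult[symmetric]) (simp add: column_def vec_eq_iff)
      also have "column i (P2_matrix nu) = (1 / r\<^sup>2) *\<^sub>R ?s (r *\<^sub>R nu i)"
        using elim by (simp add: P2_matrix_def matrix_of_columns_def column_def vecsym_def outer_def vec_eq_iff power2_eq_square)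
      also have "(2 / r\<^sup>2) *\<^sub>R (N0 *v column i (S r)) - N2 *v ((1 / r\<^sup>2) *\<^sub>R ?s (r *\<^sub>R nu i))
          = (2 / r\<^sup>2) *\<^sub>R (N0 *v v (r *\<^sub>R nu i) - (1/2) *\<^sub>R (N2 *v ?s (r *\<^sub>R nu i)))"
        by (simp add: col_S matrix_vector_mult_scaleR scaleR_diff_right)
      also have "norm \<dots> \<le> (2 / r\<^sup>2) * (b * r ^ 3)"
        unfolding norm_scaleR using elim rnu[of r i] b(1)
        by (auto intro!: mult_left_mono order_trans[OF g2] power_mono divide_right_mono)
      finally show "norm (column i ((2 / r\<^sup>2) *\<^sub>R (N0 ** S r) - N2 ** P2_matrix nu)) \<le> 2 * b * r"
        using elim by (simp add: power2_eq_square power3_eq_cube)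
    qed
  qed
  have V2: "\<forall>\<^sub>F r in at_right 0. first_left_singular_vectors ((2 / r\<^sup>2) *\<^sub>R (N0 ** S r)) (U2 r)"
    using U2 small[OF zero_less_one]
    by eventually_elim (auto simp: S_def N0_def intro: first_left_singular_vectors_scaleR)
  obtain K2 where K2: "0 \<le> K2"
    and ev2: "\<forall>\<^sub>F r in at_right 0. \<forall>x. norm ((U2 r - U2s ** O2 r) *v x) \<le> K2 * r * norm x"
    and ran2: "\<forall>\<^sub>F r in at_right 0. \<forall>k. column k (U2 r) \<in> range ((*v) ((2 / r\<^sup>2) *\<^sub>R (N0 ** S r)))"
    by (rule singular_vectors_perturbation[OF U2s' rank2 T2 V2 O2]) blast

  obtain KA where KA: "0 \<le> KA" "\<And>x. norm (matrix_inv As *v x) \<le> KA * norm x"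
    by (rule matrix_mult_bounded[of "matrix_inv As"]) blast
  obtain KJ where KJ: "0 \<le> KJ" "\<And>x. norm (J0 *v x) \<le> KJ * norm x"
    by (rule matrix_mult_bounded[of "J0"]) blast
  obtain KR where KR: "0 \<le> KR" "\<And>x. norm (R_matrix U Pi0 U2s *v x) \<le> KR * norm x"
    by (rule matrix_mult_bounded[of "R_matrix U Pi0 U2s"]) blast
  \<comment> \<open>\<open>C2 * r * norm x\<close> bounds the distance of \<open>B r *v \<alpha>1 r x\<close> from \<open>x\<close>. In \<open>C4\<close>, the factor 3 comes from $\|x\| + \|y\| \le 3\|x\|$.\<close>
  define C2 where "C2 = KA * (b1 + K1 * (KJ + b1))"
  define C4 where "C4 = b + K2 * b1 + KR * (m * (3 * C2))"
  have C2: "0 \<le> C2" and C4: "0 \<le> C4"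
    using KA(1) b1 K1 KJ(1) b(1) K2 KR(1) m(1) by (simp_all add: C2_def C4_def)

  have tiny: "\<forall>\<^sub>F r in at_right 0. 0 < r \<and> r < 1 / (2 * C2 + 1)"
    using C2 by (intro small) simp

  have main: "\<forall>\<^sub>F r in at_right 0. \<forall>x\<in>cball 0 r.
      norm (\<alpha>2 r x - R r *v ?s (B r *v \<alpha>1 r x)) \<le> C4 * r * (norm x)\<^sup>2 \<and>
      norm x \<le> 2 * KA * norm (\<alpha>1 r x) \<and> norm x \<le> r"
    using small[OF zero_less_one] tiny ev1 ev2 ran2 O1 O2
  proof eventually_elim
    case (elim r)
    have r: "0 < r" "r < 1" "C2 * r \<le> 1 / 2"
      using elim(1,2) C2 by (auto simp: field_simps)
    have O1r: "O1 r *v (transpose (O1 r) *v z) = z" "norm (O1 r *v z) = norm z" for z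
      using elim(6) norm_mult_orthonormal_columns[of "O1 r" z]
      by (simp_all add: procrustes_minimizer_def orthogonal_matrix_def matrix_vector_mul_assoc)
    have O2r: "norm (transpose (O2 r) *v z) = norm z" for z
      using elim(7) norm_mult_orthonormal_columns[of "transpose (O2 r)" z]
      by (simp add: procrustes_minimizer_def orthogonal_matrix_def)
    define E1 E2 where "E1 = U1 r - U1s ** O1 r" and "E2 = U2 r - U2s ** O2 r"
    have E1: "norm (transpose E1 *v z) \<le> K1 * r * norm z" for z
      using elim(3) by (intro norm_transpose_mult_le) (simp add: E1_def)
    have E2: "norm (transpose E2 *v z) \<le> K2 * r * norm z" for z
      using elim(4) by (intro norm_transpose_mult_le) (simp add: E2_def)
    have U2_U1s: "transpose (U2 r) *v (U1s *v z) = 0" for z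
    proof -
      have "(transpose (U2 r) *v (U1s *v z)) $ k = 0" for k
      proof -
        obtain z' where "column k (U2 r) = ((2 / r\<^sup>2) *\<^sub>R (N0 ** S r)) *v z'"
          using elim(5) by blast
        then have "column k (U2 r) = N0 *v ((2 / r\<^sup>2) *\<^sub>R (S r *v z'))"
          by (simp add: matrix_vector_mult_scaleR flip: matrix_vector_mul_assoc scaleR_matrix_vector_assoc)
        moreover have "transpose U1s *v (N0 *v u) = 0" for u
          by (simp add: N0 matrix_vector_mult_diff_distrib matrix_vector_mul_assoc[of "transpose U1s" U1s] oW)
        ultimately have "transpose U1s *v column k (U2 r) = 0"
          by simp
        then have "column k (U2 r) \<bullet> (U1s *v z) = 0"
          using inner_matrix_vector_mult[of U1s z "column k (U2 r)"] by (simp add: inner_commute)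
        then show ?thesis
          by (simp add: matrix_vector_mul_component column_def transpose_def row_def)
      qed
      then show ?thesis
        by (simp add: vec_eq_iff)
    qed
    show ?case
    proof
      fix x :: "real^('q::{finite,linorder})" assume "x \<in> cball 0 r"
      then have x: "norm x \<le> r" "x \<in> cball 0 1"
        using r by auto
      have sq: "(norm x)\<^sup>2 \<le> r * norm x" "norm x ^ 3 \<le> r * (norm x)\<^sup>2"
        using x(1) by (auto simp: power2_eq_square power3_eq_cube mult.assoc intro!: mult_right_mono)
      have "(norm x)\<^sup>2 \<le> 1 * norm x"
        using x(2) unfolding power2_eq_square by (intro mult_right_mono) auto
      then have "b1 * (norm x)\<^sup>2 \<le> b1 * norm x"
        using b1 by (intro mult_left_mono) auto
      then have vx: "norm (v x) \<le> (KJ + b1) * norm x"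
        using g[OF x(2)] KJ(2)[of x] norm_triangle_sub[of "v x" "J0 *v x"] by (simp add: distrib_right)

      define y where "y = B r *v \<alpha>1 r x"
      have y_eq: "y = matrix_inv As *v (O1 r *v \<alpha>1 r x)"
        by (simp add: y_def B matrix_vector_mul_assoc)
      have "O1 r *v \<alpha>1 r x = transpose U1s *v v x + O1 r *v (transpose E1 *v v x)"
        using transpose_mult_split[of "U1 r" "v x" "O1 r" U1s]
        by (simp add: \<alpha>1 E1_def matrix_vector_right_distrib O1r(1))
      also have "transpose U1s *v v x = As *v x + transpose U1s *v (v x - J0 *v x)"
        by (simp add: As matrix_vector_mult_diff_distrib matrix_vector_mul_assoc)
      finally have "y - x = matrix_inv As *v (transpose U1s *v (v x - J0 *v x) + O1 r *v (transpose E1 *v v x))"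
        by (simp add: y_eq matrix_vector_right_distrib inv)
      also have "norm \<dots> \<le> KA * norm (transpose U1s *v (v x - J0 *v x) + O1 r *v (transpose E1 *v v x))"
        by (rule KA(2))
      also have "\<dots> \<le> KA * (b1 * (r * norm x) + K1 * r * ((KJ + b1) * norm x))"
      proof (intro mult_left_mono order_trans[OF norm_triangle_ineq] add_mono KA(1))
        show "norm (transpose U1s *v (v x - J0 *v x)) \<le> b1 * (r * norm x)"
          using norm_transpose_mult_orthonormal_columns[OF oW] g[OF x(2)] mult_left_mono[OF sq(1) b1]
          by (meson order_trans)
        show "norm (O1 r *v (transpose E1 *v v x)) \<le> K1 * r * ((KJ + b1) * norm x)"
          unfolding O1r(2) using r(1) K1 by (intro order_trans[OF E1 mult_left_mono[OF vx]]) simp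
      qed
      also have "\<dots> = C2 * r * norm x"
        by (simp add: C2_def algebra_simps)
      finally have yx: "norm (y - x) \<le> C2 * r * norm x" .
      also have "\<dots> \<le> 1 / 2 * norm x"
        using r(3) by (rule mult_right_mono) simp
      finally have yx': "norm (y - x) \<le> 1 / 2 * norm x" .
      have "norm y \<le> KA * norm (\<alpha>1 r x)"
        using KA(2)[of "O1 r *v \<alpha>1 r x"] by (simp add: y_eq O1r(2))
      then have lower: "norm x \<le> 2 * KA * norm (\<alpha>1 r x)"
        using yx' norm_triangle_sub[of x y] by (simp add: norm_minus_commute)
      have xy: "norm x + norm y \<le> 3 * norm x"
        using yx' norm_triangle_sub[of y x] norm_ge_zero[of x] by linarith

      \<comment> \<open>The tangential part of \<open>v x\<close> is invisible to \<open>U2 r\<close>, whose columns lie in the range of \<open>N0\<close>.\<close>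
      have "v x = N0 *v v x + U1s *v (transpose U1s *v v x)"
        by (simp add: N0)
      then have "transpose (U2 r) *v v x = transpose (U2 r) *v (N0 *v v x)"
        using U2_U1s by (metis add.right_neutral matrix_vector_right_distrib)
      then have a2: "\<alpha>2 r x = transpose (O2 r) *v (transpose U2s *v (N0 *v v x)) + transpose E2 *v (N0 *v v x)"
        using transpose_mult_split[of "U2 r" "N0 *v v x" "O2 r" U2s] by (simp add: \<alpha>2 E2_def)
      have Rx: "R_matrix U Pi0 U2s *v ?s x = transpose U2s *v ((1/2) *\<^sub>R (N2 *v ?s x))"
        by (simp add: R_matrix_eq N2_def N0_def matrix_vector_mult_scaleR scaleR_matrix_vector_assoc[symmetric]
            matrix_vector_mul_assoc)
      have "\<alpha>2 r x - R r *v ?s y = transpose (O2 r) *v (transpose U2s *v (N0 *v v x - (1/2) *\<^sub>R (N2 *v ?s x)))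
          + transpose E2 *v (N0 *v v x) + transpose (O2 r) *v (R_matrix U Pi0 U2s *v (?s x - ?s y))"
        unfolding a2 R by (simp only: matrix_vector_mult_diff_distrib Rx matrix_vector_mul_assoc[symmetric]) simp
      also have "norm \<dots> \<le> b * (r * (norm x)\<^sup>2) + K2 * r * (b1 * (norm x)\<^sup>2)
          + KR * (m * (C2 * r * norm x * (3 * norm x)))"
      proof (intro order_trans[OF norm_triangle_ineq] add_mono)
        show "norm (transpose (O2 r) *v (transpose U2s *v (N0 *v v x - (1/2) *\<^sub>R (N2 *v ?s x)))) \<le> b * (r * (norm x)\<^sup>2)"
          unfolding O2r
          using norm_transpose_mult_orthonormal_columns[OF oU2s] g2[OF x(2)] mult_left_mono[OF sq(2) b(1)]
          by (meson order_trans)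
        show "norm (transpose E2 *v (N0 *v v x)) \<le> K2 * r * (b1 * (norm x)\<^sup>2)"
          using r(1) K2 by (intro order_trans[OF E2 mult_left_mono[OF Nv]] x) simp
        have "norm (?s x - ?s y) \<le> m * (norm (x - y) * (norm x + norm y))"
          unfolding m_def by (rule norm_vecsym_outer_diff_le)
        also have "\<dots> \<le> m * (C2 * r * norm x * (3 * norm x))"
          using yx xy m(1) by (intro mult_left_mono mult_mono) (auto simp: norm_minus_commute intro: order_trans[OF norm_ge_zero])
        finally have "KR * norm (?s x - ?s y) \<le> KR * (m * (C2 * r * norm x * (3 * norm x)))"
          using KR(1) by (rule mult_left_mono)
        then show "norm (transpose (O2 r) *v (R_matrix U Pi0 U2s *v (?s x - ?s y)))
            \<le> KR * (m * (C2 * r * norm x * (3 * norm x)))"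
          unfolding O2r by (rule order_trans[OF KR(2)])
      qed
      also have "\<dots> = C4 * r * (norm x)\<^sup>2"
        by (simp add: C4_def power2_eq_square algebra_simps)
      finally show "norm (\<alpha>2 r x - R r *v ?s (B r *v \<alpha>1 r x)) \<le> C4 * r * (norm x)\<^sup>2 \<and>
          norm x \<le> 2 * KA * norm (\<alpha>1 r x) \<and> norm x \<le> r"
        using lower x(1) by (simp add: y_def)
    qed
  qed

  have bound1: "\<forall>\<^sub>F r in at_right 0. \<forall>x\<in>cball 0 r. norm (\<alpha>2 r x - R r *v ?s (B r *v \<alpha>1 r x))
      \<le> C4 * (2 * KA)\<^sup>2 * (r * norm (\<alpha>1 r x) ^ 2 + norm (\<alpha>1 r x) ^ 3)"
    using main small[OF zero_less_one]
  proof eventually_elim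
    case (elim r)
    show ?case
    proof
      fix x :: "real^('q::{finite,linorder})" assume "x \<in> cball 0 r"
      then have "norm (\<alpha>2 r x - R r *v ?s (B r *v \<alpha>1 r x)) \<le> C4 * r * (norm x)\<^sup>2"
        and x: "norm x \<le> 2 * KA * norm (\<alpha>1 r x)"
        using elim by auto
      note this(1)
      also have "C4 * r * (norm x)\<^sup>2 \<le> C4 * r * (2 * KA * norm (\<alpha>1 r x))\<^sup>2"
        using x C4 elim by (intro mult_left_mono power_mono) auto
      also have "\<dots> = C4 * (2 * KA)\<^sup>2 * (r * norm (\<alpha>1 r x) ^ 2)"
        by (simp add: power_mult_distrib)
      also have "\<dots> \<le> C4 * (2 * KA)\<^sup>2 * (r * norm (\<alpha>1 r x) ^ 2 + norm (\<alpha>1 r x) ^ 3)"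
        using C4 by (intro mult_left_mono) auto
      finally show "norm (\<alpha>2 r x - R r *v ?s (B r *v \<alpha>1 r x))
          \<le> C4 * (2 * KA)\<^sup>2 * (r * norm (\<alpha>1 r x) ^ 2 + norm (\<alpha>1 r x) ^ 3)" .
    qed
  qed
  have bound2: "\<forall>\<^sub>F r in at_right 0. \<forall>x\<in>cball 0 r. norm (\<alpha>2 r x - R r *v ?s (B r *v \<alpha>1 r x)) \<le> C4 * r ^ 3"
    using main small[OF zero_less_one]
  proof eventually_elim
    case (elim r)
    show ?case
    proof
      fix x :: "real^('q::{finite,linorder})" assume "x \<in> cball 0 r"
      then have "norm (\<alpha>2 r x - R r *v ?s (B r *v \<alpha>1 r x)) \<le> C4 * r * (norm x)\<^sup>2"
        and x: "norm x \<le> r"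
        using elim by auto
      note this(1)
      also have "C4 * r * (norm x)\<^sup>2 \<le> C4 * r * r\<^sup>2"
        using x C4 elim by (intro mult_left_mono power_mono) auto
      finally show "norm (\<alpha>2 r x - R r *v ?s (B r *v \<alpha>1 r x)) \<le> C4 * r ^ 3"
        by (simp add: power2_eq_square power3_eq_cube mult.assoc)
    qed
  qed
  show ?thesis
    using bound1 bound2 homogeneous_quadratic_vecsym by blast
qed

end
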